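(* Let $S=K[x_1,\ldots,x_n]$ be a standard graded polynomial ring over a field $K$ and let $I\subset S$ be a monomial ideal such that $\alpha(I)=2$ and $I$ has a linear resolution. Then $\mathrm{v}(I^k)=2k-1$ for all $k\geq 1$.
   Context: $S=\bigoplus_{d\ge 0}S_d$ is graded with $\deg x_i=1$. For a nonzero graded ideal $I$, $\alpha(I):=\min\{\deg(f)\mid f\in I\setminus\{0\}\}$ (over homogeneous $f$). An equigenerated graded ideal $I$ (generated by homogeneous elements of a single degree) has a linear resolution if its Castelnuovo–Mumford regularity satisfies $\operatorname{reg}(I)=\alpha(I)$. For a proper graded ideal $I$, $\mathrm{v}(I):=\min\{d\geq 0\mid \exists f\in S_d,\ \mathfrak{p}\in\operatorname{Ass}(I)\text{ with }(I:f)=\mathfrak{p}\}$, where $\operatorname{Ass}(I)$ is the set of associated primes of $S/I$ and $(I:f)=\{g\in S\mid gf\in I\}$. *)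

theory Defs
  imports
    "HOL-Library.Poly_Mapping"
    "HOL-Library.Extended_Real"
    "HOL-Algebra.Algebraic_Closure_Type"
    "HOL-Algebra.Ideal_Product"
begin

section \<open>The standard graded polynomial ring\<close>

text \<open>
  Exponent vectors are finitely supported functions from a finite type of variables \<open>'n\<close>
  (so \<open>n = CARD('n)\<close>) to the naturals; a polynomial is a finitely supported
  function from exponent vectors to \<open>'k\<close>, with the convolution product of
  \<open>Poly_Mapping\<close>.
\<close>

type_synonym ('n, 'k) mpoly = "('n \<Rightarrow>\<^sub>0 nat) \<Rightarrow>\<^sub>0 'k"

abbreviation poly_ring :: "('n::finite, 'k::field) mpoly ring"
  where "poly_ring \<equiv> ring_of_type_algebra"

definition monomial :: "('n::finite \<Rightarrow>\<^sub>0 nat) \<Rightarrow> ('n, 'k::field) mpoly"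
  where "monomial m = Poly_Mapping.single m 1"

definition variable :: "'n::finite \<Rightarrow> ('n, 'k::field) mpoly"
  where "variable i = monomial (Poly_Mapping.single i 1)"

definition mdeg :: "('n::finite \<Rightarrow>\<^sub>0 nat) \<Rightarrow> nat"
  where "mdeg m = (\<Sum>i\<in>UNIV. Poly_Mapping.lookup m i)"

text \<open>The graded component \<open>S\<^sub>d\<close>; it contains 0.\<close>

definition graded_comp :: "nat \<Rightarrow> ('n::finite, 'k::field) mpoly set"
  where "graded_comp d = {f. \<forall>m\<in>Poly_Mapping.keys f. mdeg m = d}"

definition irrelevant_ideal :: "('n::finite, 'k::field) mpoly set"
  where "irrelevant_ideal = Idl\<^bsub>poly_ring\<^esub> (range variable)"


section \<open>Ideals\<close>

definition monomial_ideal :: "('n::finite, 'k::field) mpoly set \<Rightarrow> bool"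
  where "monomial_ideal I \<longleftrightarrow> (\<exists>M. I = Idl\<^bsub>poly_ring\<^esub> (monomial ` M))"

text \<open>The power of an ideal is taken in the library's monoid of ideals of \<open>S\<close>
  under the ideal product.\<close>

definition ideal_power :: "('n::finite, 'k::field) mpoly set \<Rightarrow> nat \<Rightarrow> ('n, 'k) mpoly set"
  where "ideal_power I k = I [^]\<^bsub>ideals_set poly_ring\<^esub> k"

definition colon :: "('n::finite, 'k::field) mpoly set \<Rightarrow> ('n, 'k) mpoly \<Rightarrow> ('n, 'k) mpoly set"
  where "colon I f = {g. g * f \<in> I}"

text \<open>Meaningful only for nonzero graded ideals.\<close>

definition alpha :: "('n::finite, 'k::field) mpoly set \<Rightarrow> nat"
  where "alpha I = (LEAST d. \<exists>f\<in>I - {0}. f \<in> graded_comp d)"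

text \<open>The associated primes of the module \<open>S/I\<close>: the primes that are annihilators of
  elements of \<open>S/I\<close>. The annihilator of the class of \<open>f\<close> is
  \<open>colon I f\<close>.\<close>

definition Ass :: "('n::finite, 'k::field) mpoly set \<Rightarrow> ('n, 'k) mpoly set set"
  where "Ass I = {P. primeideal P poly_ring \<and> (\<exists>f. P = colon I f)}"

text \<open>Meaningful only for proper graded ideals. The choice \<open>f = 0\<close> is excluded
  automatically, since then the colon ideal is the whole ring.\<close>

definition v_number :: "('n::finite, 'k::field) mpoly set \<Rightarrow> nat"
  where "v_number I = (LEAST d. \<exists>f\<in>graded_comp d. \<exists>P\<in>Ass I. colon I f = P)"


section \<open>Graded free resolutions and regularity\<close>

text \<open>
  The data of a graded free resolution
  \<open>\<dots> \<rightarrow> F\<^sub>2 \<rightarrow> F\<^sub>1 \<rightarrow> F\<^sub>0 \<rightarrow> I \<rightarrow> 0\<close>.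
  The module \<open>F\<^sub>i\<close> has a basis \<open>e\<^sub>0, \<dots>, e\<^sub>r\<^sub>-\<^sub>1\<close> with
  \<open>r = res_rank F i\<close>, where \<open>e\<^sub>q\<close> is homogeneous of degree
  \<open>res_deg F i q\<close>; that is, \<open>F\<^sub>i\<close> is the direct sum of the
  twists \<open>S(- res_deg F i q)\<close>. The entry \<open>res_mat F i p q\<close> is the coefficient of
  the basis element \<open>p\<close> of \<open>F\<^sub>i\<close> in the image of the basis element
  \<open>q\<close> of \<open>F\<^sub>i\<^sub>+\<^sub>1\<close>, and \<open>res_gen F q\<close> is the image in
  \<open>I\<close> of the basis element \<open>q\<close> of \<open>F\<^sub>0\<close>.
  Basis degrees may be taken in the naturals because \<open>I\<close> lives in nonnegative degrees.
  Values outside the index ranges are irrelevant, and finite resolutions have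
  rank 0 from some point on.
\<close>

record (overloaded) ('n, 'k) resolution_data =
  res_rank :: "nat \<Rightarrow> nat"
  res_deg :: "nat \<Rightarrow> nat \<Rightarrow> nat"
  res_mat :: "nat \<Rightarrow> nat \<Rightarrow> nat \<Rightarrow> ('n, 'k) mpoly"
  res_gen :: "nat \<Rightarrow> ('n, 'k) mpoly"

definition free_mod :: "nat \<Rightarrow> (nat \<Rightarrow> ('n::finite, 'k::field) mpoly) set"
  where "free_mod r = {u. \<forall>q\<ge>r. u q = 0}"

definition res_diff ::
  "('n::finite, 'k::field) resolution_data \<Rightarrow> nat \<Rightarrow> (nat \<Rightarrow> ('n, 'k) mpoly) \<Rightarrow> nat \<Rightarrow> ('n, 'k) mpoly"
  where "res_diff F i u =
    (\<lambda>p. if p < res_rank F i then \<Sum>q<res_rank F (Suc i). u q * res_mat F i p q else 0)"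

definition res_aug ::
  "('n::finite, 'k::field) resolution_data \<Rightarrow> (nat \<Rightarrow> ('n, 'k) mpoly) \<Rightarrow> ('n, 'k) mpoly"
  where "res_aug F u = (\<Sum>q<res_rank F 0. u q * res_gen F q)"

text \<open>The first two conditions say that all maps are homogeneous of degree 0, the others
  that the augmented complex is exact.\<close>

definition graded_free_resolution ::
  "('n::finite, 'k::field) mpoly set \<Rightarrow> ('n, 'k) resolution_data \<Rightarrow> bool"
  where "graded_free_resolution I F \<longleftrightarrow>
    (\<forall>q<res_rank F 0. res_gen F q \<in> graded_comp (res_deg F 0 q)) \<and>
    (\<forall>i. \<forall>p<res_rank F i. \<forall>q<res_rank F (Suc i). \<forall>m\<in>Poly_Mapping.keys (res_mat F i p q).
        mdeg m + res_deg F i p = res_deg F (Suc i) q) \<and>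
    res_aug F ` free_mod (res_rank F 0) = I \<and>
    {u \<in> free_mod (res_rank F 0). res_aug F u = 0} =
      res_diff F 0 ` free_mod (res_rank F 1) \<and>
    (\<forall>i. {u \<in> free_mod (res_rank F (Suc i)). res_diff F i u = (\<lambda>_. 0)} =
      res_diff F (Suc i) ` free_mod (res_rank F (Suc (Suc i))))"

definition minimal_graded_free_resolution ::
  "('n::finite, 'k::field) mpoly set \<Rightarrow> ('n, 'k) resolution_data \<Rightarrow> bool"
  where "minimal_graded_free_resolution I F \<longleftrightarrow>
    graded_free_resolution I F \<and>
    (\<forall>i. \<forall>p<res_rank F i. \<forall>q<res_rank F (Suc i). res_mat F i p q \<in> irrelevant_ideal)"

text \<open>The number of basis elements of degree \<open>j\<close> in \<open>F\<^sub>i\<close>, which is the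
  graded Betti number \<open>\<beta>\<^sub>i\<^sub>,\<^sub>j(I)\<close> if \<open>F\<close> is a minimal
  resolution of \<open>I\<close>.\<close>

definition graded_betti :: "('n::finite, 'k::field) resolution_data \<Rightarrow> nat \<Rightarrow> nat \<Rightarrow> nat"
  where "graded_betti F i j = card {q. q < res_rank F i \<and> res_deg F i q = j}"

text \<open>
  The Castelnuovo--Mumford regularity
  \<open>max {j - i | \<beta>\<^sub>i\<^sub>,\<^sub>j(I) \<noteq> 0}\<close>, read off
  a minimal graded free resolution. Minimal graded free resolutions of \<open>I\<close> are
  unique up to isomorphism, so all terms of the infimum coincide; the infimum only picks out
  their common value. The zero ideal has regularity \<open>- \<infinity>\<close>.
\<close>

definition reg :: "('n::finite, 'k::field) mpoly set \<Rightarrow> ereal"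
  where "reg I = (INF F \<in> {F. minimal_graded_free_resolution I F}.
    Sup {ereal (real j - real i) | i j. graded_betti F i j \<noteq> 0})"

definition equigenerated :: "('n::finite, 'k::field) mpoly set \<Rightarrow> bool"
  where "equigenerated I \<longleftrightarrow> (\<exists>d. \<exists>G\<subseteq>graded_comp d. I = Idl\<^bsub>poly_ring\<^esub> G)"

definition has_linear_resolution :: "('n::finite, 'k::field) mpoly set \<Rightarrow> bool"
  where "has_linear_resolution I \<longleftrightarrow> equigenerated I \<and> reg I = ereal (real (alpha I))"

end

theory Submission
  imports Defs
begin

text \<open>
  Let \<open>I\<close> be generated by quadratic monomials, and call \<open>a\<close> and \<open>b\<close> adjacent (\<open>edge I a b\<close>)
  if \<open>x\<^sub>a x\<^sub>b \<in> I\<close>; a loop at \<open>a\<close> means \<open>x\<^sub>a\<^sup>2 \<in> I\<close>.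

  Lower bound: a prime of the form \<open>(I\<^sup>k : f)\<close> contains \<open>I\<^sup>k\<close>, hence some monomial, hence some
  variable \<open>x\<^sub>i\<close>. Then \<open>x\<^sub>i f\<close> is a nonzero element of \<open>I\<^sup>k\<close>, so \<open>deg f + 1 \<ge> 2k\<close>.

  Upper bound: suppose some vertex \<open>v\<close> has a nonempty neighbourhood \<open>N\<close> that meets every edge
  (\<open>covering_vertex\<close>). Let \<open>P\<close> be the prime generated by the variables in \<open>N\<close>. If \<open>v\<close> has no
  loop, choose \<open>y \<in> N\<close> and put \<open>f = x\<^sub>v\<^sup>k x\<^sub>y\<^sup>k\<^sup>-\<^sup>1\<close>. For \<open>i \<in> N\<close> the product
  \<open>x\<^sub>i f = (x\<^sub>i x\<^sub>v)(x\<^sub>v x\<^sub>y)\<^sup>k\<^sup>-\<^sup>1\<close> lies in \<open>I\<^sup>k\<close>. Conversely \<open>I\<^sup>k \<subseteq> P\<^sup>k\<close>, while \<open>f\<close>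
  contains only \<open>k - 1\<close> variables of \<open>P\<close>, so a monomial \<open>g\<close> with \<open>g f \<in> I\<^sup>k\<close> is in \<open>P\<close>. Hence
  \<open>(I\<^sup>k : f) = P\<close>. If \<open>v\<close> has a loop, \<open>f = x\<^sub>v\<^sup>2\<^sup>k\<^sup>-\<^sup>1\<close> works by the same count, now with weight 1
  on \<open>x\<^sub>v\<close> and weight 2 on the other variables of \<open>P\<close>. Both cases are instances of
  \<open>colon_monomial\<close>.

  It remains to find \<open>v\<close>, and here the linear resolution enters. It bounds the degrees of the
  Koszul homology of \<open>I\<close>: a Koszul cycle whose coefficients are forms of degree greater than 2 in
  \<open>I\<close> is a boundary of a chain in \<open>I\<close> (\<open>koszul_ideal_boundary\<close>, by dimension shifting along the
  resolution). Two explicit cycles exploit this. If \<open>x\<close> has a loop, a cycle of homological degree 1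
  shows that \<open>v = x\<close> works (\<open>loop_meets_edges\<close>). If there are no loops, let \<open>H\<close> be the
  complementary graph. For a vertex set \<open>W\<close> and an \<open>H\<close>-edge \<open>pq\<close> in \<open>W\<close> without common
  \<open>H\<close>-neighbour in \<open>W\<close>, the coboundary of the indicator of \<open>pq\<close> is such a cycle, and that it
  bounds in \<open>I\<close> means that \<open>p\<close> and \<open>q\<close> are disconnected in \<open>W\<close> once the edge \<open>pq\<close> is removed
  (\<open>coedge_separates\<close>). This is the form in which chordality of \<open>H\<close> (Froeberg's theorem) is used:
  an induced cycle of length at least 4 would violate it. Dirac's argument then yields a vertex
  \<open>v\<close> whose \<open>H\<close>-neighbours are pairwise \<open>H\<close>-adjacent and which is not \<open>H\<close>-adjacent to all others
  (\<open>simplicial_vertex\<close>). So \<open>v\<close> has a neighbour, and no edge avoids \<open>N\<close>.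
\<close>

section \<open>Monomials and ideals\<close>

abbreviation "keys \<equiv> Poly_Mapping.keys"
abbreviation "lookup \<equiv> Poly_Mapping.lookup"
abbreviation "single \<equiv> Poly_Mapping.single"

lemma lookup_single_times:
  fixes f :: "('n::finite, 'k::field) mpoly"
  shows "lookup (single t c * f) (t + r) = c * lookup f r"
proof -
  have "lookup (single t c * f) (t + r)
      = (\<Sum>l. (c when t = l) * (\<Sum>q. lookup f q when t + r = l + q))"
    by (simp add: times_poly_mapping.rep_eq prod_fun_def lookup_single)
  also have "\<dots> = (\<Sum>l. c * (\<Sum>q. lookup f q when t + r = l + q) when l = t)"
    by (rule Sum_any.cong) (auto simp: when_def)
  also have "\<dots> = c * lookup f r"
    by simp
  finally show ?thesis .
qed

lemma lookup_single_times_0: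
  fixes f :: "('n::finite, 'k::field) mpoly"
  assumes "\<And>r. m \<noteq> t + r"
  shows "lookup (single t c * f) m = 0"
proof -
  have "lookup (single t c * f) m
      = (\<Sum>l. (c when t = l) * (\<Sum>q. lookup f q when m = l + q))"
    by (simp add: times_poly_mapping.rep_eq prod_fun_def lookup_single)
  also have "\<dots> = (\<Sum>l. c * (\<Sum>q. lookup f q when m = l + q) when l = t)"
    by (rule Sum_any.cong) (auto simp: when_def)
  also have "\<dots> = 0"
    using assms by simp
  finally show ?thesis .
qed

lemma keys_single_times:
  fixes f :: "('n::finite, 'k::field) mpoly"
  assumes "c \<noteq> 0"
  shows "keys (single t c * f) = (\<lambda>r. t + r) ` keys f"
proof (rule Set.set_eqI, rule iffI)
  fix m assume m: "m \<in> keys (single t c * f)"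
  then obtain r where r: "m = t + r"
    using lookup_single_times_0 by (metis in_keys_iff)
  then show "m \<in> (\<lambda>r. t + r) ` keys f"
    using m by (auto simp: in_keys_iff lookup_single_times)
qed (use assms in \<open>auto simp: in_keys_iff lookup_single_times\<close>)

lemma keys_monomial [simp]: "keys (monomial m :: ('n::finite, 'k::field) mpoly) = {m}"
  by (simp add: monomial_def)

lemma monomial_times_monomial: "monomial a * monomial b = (monomial (a + b) :: ('n::finite, 'k::field) mpoly)"
  by (simp add: monomial_def mult_single)

lemma factor_out_variable: "lookup m i > 0 \<Longrightarrow> m = single i 1 + (m - single i 1)"
  for m :: "'n::finite \<Rightarrow>\<^sub>0 nat"
  by (intro poly_mapping_eqI) (auto simp: lookup_add lookup_minus lookup_single when_def)

lemma poly_sum_monomials: "f = (\<Sum>m\<in>keys f. single m (lookup f m))" 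
  for f :: "('n::finite, 'k::field) mpoly"
  by (rule poly_mapping_eqI)
    (auto simp: lookup_sum lookup_single when_def sum.delta in_keys_iff)

lemma ideal_poly_ring_iff:
  "ideal I (poly_ring :: ('n::finite, 'k::field) mpoly ring) \<longleftrightarrow>
    0 \<in> I \<and> (\<forall>f\<in>I. \<forall>g\<in>I. f + g \<in> I) \<and> (\<forall>f. \<forall>g\<in>I. f * g \<in> I)"
  (is "?L \<longleftrightarrow> ?R")
proof
  assume ?L
  then interpret ideal I "poly_ring :: ('n, 'k) mpoly ring" .
  show ?R
    using additive_subgroup.zero_closed[OF is_additive_subgroup]
      additive_subgroup.a_closed[OF is_additive_subgroup] I_l_closed
    by (auto simp: ring_of_type_algebra_def)
next
  assume R: ?R
  show ?L
  proof (rule idealI)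
    show "ring (poly_ring :: ('n, 'k) mpoly ring)" by (rule ring_from_type_algebra)
    then interpret ring "poly_ring :: ('n, 'k) mpoly ring" .
    have neg: "\<ominus>\<^bsub>poly_ring\<^esub> f = - f" for f :: "('n, 'k) mpoly"
      by (rule minus_equality) (auto simp: ring_of_type_algebra_def)
    have "- f \<in> I" if "f \<in> I" for f
      using R that by (metis mult_minus1)
    then show "subgroup I (add_monoid poly_ring)"
      using R neg by (intro add.subgroupI) (auto simp: ring_of_type_algebra_def a_inv_def)
    show "x \<otimes>\<^bsub>poly_ring\<^esub> a \<in> I" "a \<otimes>\<^bsub>poly_ring\<^esub> x \<in> I"
      if "a \<in> I" for a x :: "('n, 'k) mpoly"
      using R that by (auto simp: ring_of_type_algebra_def mult.commute[of a x])
  qed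
qed

lemma
  assumes "ideal I (poly_ring :: ('n::finite, 'k::field) mpoly ring)"
  shows ideal_zero: "0 \<in> I"
    and ideal_add: "f \<in> I \<Longrightarrow> g \<in> I \<Longrightarrow> f + g \<in> I"
    and ideal_mult: "g \<in> I \<Longrightarrow> f * g \<in> I"
  using assms unfolding ideal_poly_ring_iff by auto

lemma ideal_sum:
  assumes "ideal I (poly_ring :: ('n::finite, 'k::field) mpoly ring)" "\<And>a. a \<in> A \<Longrightarrow> f a \<in> I"
  shows "sum f A \<in> I"
  using assms(2) by (induction A rule: infinite_finite_induct) (auto intro: ideal_zero ideal_add assms(1))

lemma ideal_Idl: "ideal (Idl\<^bsub>poly_ring\<^esub> G) (poly_ring :: ('n::finite, 'k::field) mpoly ring)"
  by (rule ring.genideal_ideal[OF ring_from_type_algebra]) (simp add: ring_of_type_algebra_def)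

lemma subset_Idl: "G \<subseteq> Idl\<^bsub>poly_ring\<^esub> (G :: ('n::finite, 'k::field) mpoly set)"
  by (rule ring.genideal_self[OF ring_from_type_algebra]) (simp add: ring_of_type_algebra_def)

lemma Idl_subset:
  assumes "ideal J (poly_ring :: ('n::finite, 'k::field) mpoly ring)" "G \<subseteq> J"
  shows "Idl\<^bsub>poly_ring\<^esub> G \<subseteq> J"
  by (rule ring.genideal_minimal[OF ring_from_type_algebra assms])

lemma ideal_if_monomials:
  assumes I: "ideal I (poly_ring :: ('n::finite, 'k::field) mpoly ring)"
    and "\<And>m. m \<in> keys f \<Longrightarrow> monomial m \<in> I"
  shows "f \<in> I"
proof -
  have "single m (lookup f m) \<in> I" if "m \<in> keys f" for m
  proof -
    have "single 0 (lookup f m) * monomial m \<in> I"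
      using ideal_mult[OF I] assms(2)[OF that] by blast
    then show ?thesis by (simp add: monomial_def mult_single)
  qed
  then show ?thesis
    by (subst poly_sum_monomials) (auto intro: ideal_sum[OF I])
qed

text \<open>
  For a set of exponents that is closed under multiplication by monomials, this is the ideal
  spanned by the corresponding monomials.
\<close>

definition supported_on :: "('n::finite \<Rightarrow>\<^sub>0 nat) set \<Rightarrow> ('n, 'k::field) mpoly set"
  where "supported_on U = {f. keys f \<subseteq> U}"

lemma ideal_supported_on:
  assumes "\<And>u r. u \<in> U \<Longrightarrow> r + u \<in> U"
  shows "ideal (supported_on U) (poly_ring :: ('n::finite, 'k::field) mpoly ring)"
  unfolding ideal_poly_ring_iff
proof (intro conjI ballI allI)
  show "0 \<in> (supported_on U :: ('n, 'k) mpoly set)" by (simp add: supported_on_def)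
next
  fix f g :: "('n, 'k) mpoly" assume "f \<in> supported_on U" "g \<in> supported_on U"
  then show "f + g \<in> supported_on U" using keys_add[of f g] by (auto simp: supported_on_def)
next
  fix f g :: "('n, 'k) mpoly" assume "g \<in> supported_on U"
  then show "f * g \<in> supported_on U" using keys_mult[of f g] assms by (fastforce simp: supported_on_def)
qed

lemma monomial_ideal_ideal:
  "monomial_ideal I \<Longrightarrow> ideal I (poly_ring :: ('n::finite, 'k::field) mpoly ring)"
  unfolding monomial_ideal_def using ideal_Idl by auto

lemma mem_monomial_ideal_iff:
  fixes I :: "('n::finite, 'k::field) mpoly set"
  assumes "monomial_ideal I"
  shows "f \<in> I \<longleftrightarrow> (\<forall>m\<in>keys f. monomial m \<in> I)"
proof
  obtain M where M: "I = Idl\<^bsub>poly_ring\<^esub> (monomial ` M)"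
    using assms unfolding monomial_ideal_def by auto
  note I = monomial_ideal_ideal[OF assms]
  let ?U = "{m. (monomial m :: ('n, 'k) mpoly) \<in> I}"
  have "ideal (supported_on ?U) (poly_ring :: ('n, 'k) mpoly ring)"
    by (rule ideal_supported_on) (use ideal_mult[OF I] in \<open>auto simp flip: monomial_times_monomial\<close>)
  moreover have "monomial ` M \<subseteq> (supported_on ?U :: ('n, 'k) mpoly set)"
    using subset_Idl[of "monomial ` M"] by (auto simp: M supported_on_def)
  ultimately have "I \<subseteq> supported_on ?U"
    unfolding M by (rule Idl_subset)
  then show "f \<in> I \<Longrightarrow> \<forall>m\<in>keys f. monomial m \<in> I"
    by (auto simp: supported_on_def)
qed (auto intro: ideal_if_monomials[OF monomial_ideal_ideal[OF assms]])

lemma ideal_power_0: "ideal_power I 0 = (UNIV :: ('n::finite, 'k::field) mpoly set)"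
  by (simp add: ideal_power_def ideals_set_def ring_of_type_algebra_def nat_pow_def)

lemma ideal_power_Suc: "ideal_power I (Suc k) = ideal_prod poly_ring (ideal_power I k) (I :: ('n::finite, 'k::field) mpoly set)"
  by (simp add: ideal_power_def ideals_set_def nat_pow_def)

lemma ideal_ideal_power:
  assumes "ideal I (poly_ring :: ('n::finite, 'k::field) mpoly ring)"
  shows "ideal (ideal_power I k) poly_ring"
proof (induction k)
  case 0
  show ?case by (simp add: ideal_power_0 ideal_poly_ring_iff)
next
  case (Suc k)
  show ?case
    unfolding ideal_power_Suc
    by (rule ring.ideal_prod_is_ideal[OF ring_from_type_algebra Suc assms])
qed

lemma ideal_power_Suc_mult:
  assumes "f \<in> ideal_power I k" "g \<in> (I :: ('n::finite, 'k::field) mpoly set)"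
  shows "f * g \<in> ideal_power I (Suc k)"
  using ideal_prod.prod[OF assms, of poly_ring] unfolding ideal_power_Suc by (simp add: ring_of_type_algebra_def)

lemma monomial_0: "monomial 0 = (1 :: ('n::finite, 'k::field) mpoly)"
  by (simp add: monomial_def single_one)

definition weighted_degree :: "('n \<Rightarrow> nat) \<Rightarrow> ('n::finite \<Rightarrow>\<^sub>0 nat) \<Rightarrow> nat"
  where "weighted_degree w m = (\<Sum>i\<in>UNIV. w i * lookup m i)"

lemma weighted_degree_add [simp]: "weighted_degree w (a + b) = weighted_degree w a + weighted_degree w b"
  by (simp add: weighted_degree_def lookup_add algebra_simps sum.distrib)

lemma weighted_degree_single [simp]: "weighted_degree w (single i c) = w i * c"
proof -
  have "weighted_degree w (single i c) = (\<Sum>j\<in>UNIV. if j = i then w i * c else 0)"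
    unfolding weighted_degree_def by (intro sum.cong) (auto simp: lookup_single when_def)
  then show ?thesis by simp
qed

lemma mdeg_eq_weighted_degree: "mdeg = weighted_degree (\<lambda>_. 1)"
  by (simp add: mdeg_def weighted_degree_def fun_eq_iff)

lemma weighted_degree_ideal_power:
  assumes "\<And>f m. f \<in> I \<Longrightarrow> m \<in> keys f \<Longrightarrow> c \<le> weighted_degree w m"
  assumes "f \<in> ideal_power (I :: ('n::finite, 'k::field) mpoly set) k" "m \<in> keys f"
  shows "c * k \<le> weighted_degree w m"
  using assms(2,3)
proof (induction k arbitrary: f m)
  case (Suc k)
  from Suc.prems show ?case unfolding ideal_power_Suc
  proof (induction arbitrary: m rule: ideal_prod.induct)
    case (prod i j)
    then obtain a b where "a \<in> keys i" "b \<in> keys j" "m = a + b"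
      using keys_mult[of i j] by (auto simp: ring_of_type_algebra_def)
    then show ?case
      using Suc.IH[OF prod(1)] assms(1)[OF prod(2)] by (fastforce simp: algebra_simps)
  next
    case (sum s1 s2)
    then show ?case
      using keys_add[of s1 s2] by (auto simp: ring_of_type_algebra_def)
  qed
qed simp

lemma exponent_induct [case_names zero add]:
  fixes m :: "'n::finite \<Rightarrow>\<^sub>0 nat"
  assumes "P 0" "\<And>i m. P m \<Longrightarrow> P (single i 1 + m)"
  shows "P m"
proof (induction "weighted_degree (\<lambda>_. 1) m" arbitrary: m)
  case 0
  then have "m = 0" by (intro poly_mapping_eqI) (simp add: weighted_degree_def)
  then show ?case using assms(1) by simp
next
  case (Suc d)
  then obtain i where "lookup m i > 0" unfolding weighted_degree_def
    by (metis (no_types, lifting) gr0I mult_0_right nat.distinct(1) sum.neutral)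
  then obtain r where "m = single i 1 + r" using factor_out_variable by blast
  then show ?case using Suc assms(2)[of r i] by simp
qed

section \<open>Primes generated by variables\<close>

text \<open>
  The exponents of the monomials in the ideal generated by the variables in \<open>N\<close>.
\<close>

definition meets :: "'n::finite set \<Rightarrow> ('n \<Rightarrow>\<^sub>0 nat) set"
  where "meets N = {m. \<exists>i\<in>N. lookup m i > 0}"

text \<open>
  The type of variables carries no order. Numbering the variables transports the lexicographic
  order of \<open>nat \<Rightarrow>\<^sub>0 nat\<close> to a monomial order.
\<close>

definition lex_code :: "('n::finite \<Rightarrow>\<^sub>0 nat) \<Rightarrow> (nat \<Rightarrow>\<^sub>0 nat)"
  where "lex_code m = (\<Sum>i\<in>UNIV. single (to_nat i) (lookup m i))"

lemma lookup_lex_code: "lookup (lex_code m) (to_nat i) = lookup m i"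
proof -
  have "lookup (lex_code m) (to_nat i) = (\<Sum>j\<in>UNIV. if j = i then lookup m i else 0)"
    unfolding lex_code_def lookup_sum by (intro sum.cong) (auto simp: lookup_single when_def)
  then show ?thesis by simp
qed

lemma lex_code_inj: "lex_code a = lex_code b \<Longrightarrow> a = b"
  by (intro poly_mapping_eqI) (metis lookup_lex_code)

lemma lex_code_add: "lex_code (a + b) = lex_code a + lex_code b"
  by (simp add: lex_code_def lookup_add single_add sum.distrib)

text \<open>
  If neither factor is in the ideal, the product of their leading terms outside the ideal cannot
  cancel: any other pair of terms with the same product also lies outside the ideal, yet one of the
  two would exceed the corresponding leading term in the monomial order.
\<close>

lemma primeideal_supported_on_meets:
  "primeideal (supported_on (meets N)) (poly_ring :: ('n::finite, 'k::field) mpoly ring)"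
proof (rule primeidealI)
  show "ideal (supported_on (meets N)) (poly_ring :: ('n, 'k) mpoly ring)"
    by (rule ideal_supported_on) (auto simp: meets_def lookup_add)
  show "cring (poly_ring :: ('n, 'k) mpoly ring)" by (rule cring_from_type_algebra)
  have "(1 :: ('n, 'k) mpoly) \<notin> supported_on (meets N)"
    by (simp add: supported_on_def meets_def)
  then show "carrier poly_ring \<noteq> (supported_on (meets N) :: ('n, 'k) mpoly set)"
    by (auto simp: ring_of_type_algebra_def)
next
  fix f g :: "('n, 'k) mpoly"
  assume "f \<otimes>\<^bsub>poly_ring\<^esub> g \<in> supported_on (meets N)"
  then have fg: "keys (f * g) \<subseteq> meets N" by (simp add: supported_on_def ring_of_type_algebra_def)
  show "f \<in> supported_on (meets N) \<or> g \<in> supported_on (meets N)"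
  proof (rule ccontr)
    assume "\<not> ?thesis"
    then have ne: "keys f - meets N \<noteq> {}" "keys g - meets N \<noteq> {}"
      by (auto simp: supported_on_def)
    have top: "\<exists>a\<in>keys h - meets N. \<forall>b\<in>keys h - meets N. lex_code b \<le> lex_code a"
      if "keys h - meets N \<noteq> {}" for h :: "('n, 'k) mpoly"
    proof -
      have fin: "finite (lex_code ` (keys h - meets N))" by simp
      have "Max (lex_code ` (keys h - meets N)) \<in> lex_code ` (keys h - meets N)"
        using that by (intro Max_in) auto
      then show ?thesis
        using Max_ge[OF fin] by (metis (no_types, lifting) imageE image_eqI)
    qed
    from top[OF ne(1)] obtain a where a: "a \<in> keys f" "a \<notin> meets N"
      and amax: "\<And>b. b \<in> keys f \<Longrightarrow> b \<notin> meets N \<Longrightarrow> lex_code b \<le> lex_code a" by auto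
    from top[OF ne(2)] obtain c where c: "c \<in> keys g" "c \<notin> meets N"
      and cmax: "\<And>b. b \<in> keys g \<Longrightarrow> b \<notin> meets N \<Longrightarrow> lex_code b \<le> lex_code c" by auto
    have ac: "a + c \<notin> meets N" using a(2) c(2) by (auto simp: meets_def lookup_add)
    have uniq: "l = a \<and> q = c" if "l \<in> keys f" "q \<in> keys g" "a + c = l + q" for l q
    proof -
      have "l \<notin> meets N" "q \<notin> meets N" using ac that(3) by (auto simp: meets_def lookup_add)
      then have "lex_code l \<le> lex_code a" "lex_code q \<le> lex_code c"
        using amax cmax that by auto
      moreover have "lex_code a + lex_code c = lex_code l + lex_code q"
        using that(3) by (metis lex_code_add)
      ultimately have "lex_code l = lex_code a"
        by (metis add_le_less_mono add_less_le_mono order_le_less order_less_irrefl)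
      then have "l = a" by (rule lex_code_inj)
      then show ?thesis using that(3) by simp
    qed
    have "lookup (f * g) (a + c)
        = (\<Sum>l. lookup f l * (\<Sum>q. lookup g q when a + c = l + q))"
      by (simp add: times_poly_mapping.rep_eq prod_fun_def)
    also have "\<dots> = (\<Sum>l. lookup f a * lookup g c when l = a)"
    proof (rule Sum_any.cong)
      fix l
      have "lookup f l * (lookup g q when a + c = l + q)
          = ((lookup f a * lookup g c when q = c) when l = a)" for q
        using uniq[of l q] by (auto simp: when_def in_keys_iff)
      then have "(\<Sum>q. lookup f l * (lookup g q when a + c = l + q))
          = (\<Sum>q. (lookup f a * lookup g c when q = c) when l = a)" by simp
      then have *: "(\<Sum>q. lookup f l * (lookup g q when a + c = l + q)) = (lookup f a * lookup g c when l = a)"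
        by (cases "l = a") auto
      have "finite {q. (lookup g q when a + c = l + q) \<noteq> 0}"
        by (rule finite_subset[of _ "keys g"]) (auto simp: in_keys_iff when_def)
      from Sum_any_right_distrib[OF this, of "lookup f l"] *
      show "lookup f l * (\<Sum>q. lookup g q when a + c = l + q) = (lookup f a * lookup g c when l = a)"
        by simp
    qed
    also have "\<dots> = lookup f a * lookup g c" by simp
    also have "\<dots> \<noteq> 0" using a c by (simp add: in_keys_iff)
    finally have "a + c \<in> keys (f * g)" by (simp add: in_keys_iff)
    then show False using fg ac by blast
  qed
qed

text \<open>Exponents of variables stay in the form \<open>single i 1\<close>.\<close>

declare One_nat_def [simp del]

section \<open>The Koszul complex\<close>

text \<open>
  The sign of the permutation that sorts \<open>i\<close> into the wedge product over \<open>A\<close>, with respect to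
  the numbering \<open>to_nat\<close> of the variables.
\<close>

definition ksgn :: "'n::finite \<Rightarrow> 'n set \<Rightarrow> 'k::field"
  where "ksgn i A = (-1) ^ card {j \<in> A. to_nat j < to_nat i}"

lemma ksgn_insert:
  assumes "j \<notin> A"
  shows "ksgn i (insert j A) = (if to_nat j < to_nat i then - ksgn i A else ksgn i A)"
proof -
  have "{l \<in> insert j A. to_nat l < to_nat i} =
      (if to_nat j < to_nat i then insert j {l \<in> A. to_nat l < to_nat i} else {l \<in> A. to_nat l < to_nat i})"
    by auto
  then show ?thesis using assms by (simp add: ksgn_def)
qed

lemma ksgn_square: "ksgn i A * ksgn i A = 1"
  by (simp add: ksgn_def flip: power_add mult_2)

lemma ksgn_nonzero [simp]: "ksgn i A \<noteq> 0"
  by (simp add: ksgn_def)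

lemma ksgn_swap:
  fixes A :: "'n::finite set"
  assumes "i \<noteq> j" "i \<notin> A" "j \<notin> A"
  shows "ksgn i (insert j A) * ksgn j (insert i A) = - (ksgn i A * ksgn j A :: 'k::field)"
    and "ksgn i A * ksgn j (insert i A) = - (ksgn j A * ksgn i (insert j A) :: 'k)"
proof -
  have "to_nat i \<noteq> to_nat j" using assms by simp
  then show "ksgn i (insert j A) * ksgn j (insert i A) = - (ksgn i A * ksgn j A :: 'k)"
    and "ksgn i A * ksgn j (insert i A) = - (ksgn j A * ksgn i (insert j A) :: 'k)"
    using assms by (auto simp: ksgn_insert)
qed

text \<open>
  The differential of the Koszul complex on all variables. A chain of homological degree \<open>r\<close> is a
  function \<open>\<phi>\<close> whose values \<open>\<phi> A\<close> with \<open>card A = r\<close> are the coefficients of the exterior basis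
  elements. A function on all sets thus represents chains of all degrees at once; the value of the
  differential at \<open>A\<close> depends only on the sets with \<open>card A + 1\<close> elements, so statements about a
  single homological degree simply restrict the cardinality.
\<close>

definition koszul :: "('n set \<Rightarrow> ('n::finite, 'k::field) mpoly) \<Rightarrow> 'n set \<Rightarrow> ('n, 'k) mpoly"
  where "koszul \<phi> A = (\<Sum>i\<in>-A. single (single i 1) (ksgn i A) * \<phi> (insert i A))"

lemma koszul_cong:
  assumes "\<And>B. card B = Suc (card A) \<Longrightarrow> \<phi> B = \<psi> B"
  shows "koszul \<phi> A = koszul \<psi> A"
  unfolding koszul_def by (intro sum.cong) (auto simp: assms)

lemma koszul_diff: "koszul (\<lambda>B. \<phi> B - \<psi> B) A = koszul \<phi> A - koszul \<psi> A"
  by (simp add: koszul_def algebra_simps sum_subtractf)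

lemma koszul_linear_combination:
  "koszul (\<lambda>B. \<Sum>q\<in>Q. \<phi> q B * a q) A = (\<Sum>q\<in>Q. koszul (\<phi> q) A * a q)"
  unfolding koszul_def sum_distrib_left sum_distrib_right
  by (subst sum.swap) (simp add: mult.assoc)

lemma koszul_0 [simp]: "koszul (\<lambda>B. 0) A = 0"
  by (simp add: koszul_def)

lemma sum_antisymmetric:
  fixes f :: "'a \<Rightarrow> 'a \<Rightarrow> 'b::ab_group_add"
  assumes "finite V" "\<And>i j. i \<in> V \<Longrightarrow> j \<in> V \<Longrightarrow> i \<noteq> j \<Longrightarrow> f i j = - f j i"
  shows "(\<Sum>i\<in>V. \<Sum>j\<in>V - {i}. f i j) = 0"
  using assms
proof (induction V rule: finite_induct)
  case (insert a V)
  have "(\<Sum>i\<in>insert a V. \<Sum>j\<in>insert a V - {i}. f i j)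
      = (\<Sum>j\<in>V. f a j) + (\<Sum>i\<in>V. \<Sum>j\<in>insert a (V - {i}). f i j)"
  proof -
    have "insert a V - {i} = insert a (V - {i})" if "i \<in> V" for i using that insert.hyps by auto
    then show ?thesis using insert.hyps by simp
  qed
  also have "(\<Sum>i\<in>V. \<Sum>j\<in>insert a (V - {i}). f i j) = (\<Sum>i\<in>V. f i a) + (\<Sum>i\<in>V. \<Sum>j\<in>V - {i}. f i j)"
    using insert.hyps by (simp add: sum.distrib)
  also have "(\<Sum>i\<in>V. f i a) = (\<Sum>i\<in>V. - f a i)"
    using insert.hyps by (intro sum.cong refl insert.prems) auto
  also have "(\<Sum>i\<in>V. \<Sum>j\<in>V - {i}. f i j) = 0"
    by (intro insert.IH insert.prems) auto
  finally show ?case by (simp only: sum_negf add.right_inverse add_0_right)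
qed simp

lemma koszul_koszul:
  fixes \<phi> :: "'n::finite set \<Rightarrow> ('n, 'k::field) mpoly"
  shows "koszul (koszul \<phi>) A = 0"
proof -
  let ?T = "\<lambda>i j. single (single i 1) (ksgn i A) *
    (single (single j 1) (ksgn j (insert i A)) * \<phi> (insert j (insert i A)))"
  have "koszul (koszul \<phi>) A = (\<Sum>i\<in>-A. \<Sum>j\<in>-A - {i}. ?T i j)"
    unfolding koszul_def sum_distrib_left by (intro sum.cong) auto
  also have "\<dots> = 0"
  proof (rule sum_antisymmetric)
    fix i j assume ij: "i \<in> -A" "j \<in> -A" "i \<noteq> j"
    have "single (single i 1) (ksgn i A) * single (single j 1) (ksgn j (insert i A))
        = - (single (single j 1) (ksgn j A) * single (single i 1) (ksgn i (insert j A)) :: ('n, 'k) mpoly)"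
      using ij ksgn_swap(2)[of i j A, where 'k = 'k] by (simp add: mult_single add.commute single_uminus)
    then show "?T i j = - ?T j i"
      by (simp add: insert_commute flip: mult.assoc)
  qed simp
  finally show ?thesis .
qed

lemma lookup_variable_times:
  fixes f :: "('n::finite, 'k::field) mpoly"
  shows "lookup (single (single i 1) c * f) m = (if lookup m i > 0 then c * lookup f (m - single i 1) else 0)"
proof (cases "lookup m i > 0")
  case True
  then show ?thesis
    using lookup_single_times[of "single i 1" c f "m - single i 1"] factor_out_variable[OF True] by simp
next
  case False
  then have "m \<noteq> single i 1 + r" for r by (auto simp: lookup_add)
  then show ?thesis using False lookup_single_times_0 by metis
qed

lemma lookup_koszul:
  "lookup (koszul \<phi> A) m =
    (\<Sum>i\<in>-A. if lookup m i > 0 then ksgn i A * lookup (\<phi> (insert i A)) (m - single i 1) else 0)"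
  by (simp add: koszul_def lookup_sum lookup_variable_times)

definition squarefree_exponent :: "'n::finite set \<Rightarrow> ('n \<Rightarrow>\<^sub>0 nat)"
  where "squarefree_exponent A = (\<Sum>i\<in>A. single i 1)"

lemma lookup_squarefree_exponent [simp]: "lookup (squarefree_exponent A) i = (if i \<in> A then 1 else 0)"
  by (simp add: squarefree_exponent_def lookup_sum lookup_single when_def)

text \<open>
  The Koszul complex of the polynomial ring splits into multidegrees \<open>a\<close>, with
  \<open>a = m + squarefree_exponent A\<close> for the coefficient of \<open>m\<close> in \<open>\<phi> A\<close>. The part of multidegree
  \<open>a\<close> is the augmented chain complex of the full simplex on the support of \<open>a\<close>. If \<open>a \<noteq> 0\<close>, it is
  contractible by the cone from any chosen vertex \<open>pick a\<close> of the support. The only homology lives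
  in multidegree 0, hence the condition on the constant term for \<open>A = {}\<close>.
\<close>

lemma koszul_exact:
  fixes \<phi> :: "'n::finite set \<Rightarrow> ('n, 'k::field) mpoly"
  shows "\<exists>\<eta>. \<forall>A. (\<forall>i\<in>A. koszul \<phi> (A - {i}) = 0) \<and> (A = {} \<longrightarrow> lookup (\<phi> {}) 0 = 0) \<longrightarrow> \<phi> A = koszul \<eta> A"
proof -
  define pick where "pick a = (SOME i. lookup a i > 0)" for a :: "'n \<Rightarrow>\<^sub>0 nat"
  have pick: "lookup a (pick a) > 0" if "a \<noteq> 0" for a
    unfolding pick_def
  proof (rule someI_ex, rule ccontr)
    assume "\<nexists>i. lookup a i > 0"
    then have "a = 0" by (intro poly_mapping_eqI) simp
    then show False using that by simp
  qed
  define h where "h B m = (let i = pick (m + squarefree_exponent B) in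
      if i \<in> B then ksgn i (B - {i}) * lookup (\<phi> (B - {i})) (m + single i 1) else 0)" for B m
  define \<eta> where "\<eta> B = Abs_poly_mapping (h B)" for B
  have "finite {m. h B m \<noteq> 0}" for B
  proof (rule finite_subset)
    show "{m. h B m \<noteq> 0} \<subseteq> (\<Union>i\<in>B. (\<lambda>m. m + single i 1) -` keys (\<phi> (B - {i})))"
      by (auto simp: h_def Let_def in_keys_iff split: if_splits)
    show "finite (\<Union>i\<in>B. (\<lambda>m. m + single i 1) -` keys (\<phi> (B - {i})))"
      by (intro finite_UN_I finite_vimageI) (auto simp: inj_on_def)
  qed
  then have lookup_\<eta>: "lookup (\<eta> B) = h B" for B by (simp add: \<eta>_def)
  have "\<phi> A = koszul \<eta> A"
    if cycle: "\<And>i. i \<in> A \<Longrightarrow> koszul \<phi> (A - {i}) = 0" and const: "A = {} \<Longrightarrow> lookup (\<phi> {}) 0 = 0" for A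
  proof (rule poly_mapping_eqI)
    fix m
    define a where "a = m + squarefree_exponent A"
    have shift: "m - single i 1 + squarefree_exponent (insert i A) = a" if "i \<notin> A" "lookup m i > 0" for i
      unfolding a_def using that
      by (intro poly_mapping_eqI) (auto simp: lookup_add lookup_minus lookup_single when_def)
    show "lookup (\<phi> A) m = lookup (koszul \<eta> A) m"
    proof (cases "a = 0")
      case True
      then have "lookup m i = 0" "i \<notin> A" for i
        using lookup_add[of m "squarefree_exponent A" i] by (auto simp: a_def split: if_splits)
      then have "A = {}" "m = 0" by (auto intro: poly_mapping_eqI)
      then show ?thesis using const by (simp add: lookup_koszul)
    next
      case False
      define k where "k = pick a"
      have k: "lookup a k > 0" using pick[OF False] by (simp add: k_def)
      have summand: "lookup (\<eta> (insert i A)) (m - single i 1) =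
          (if k \<in> insert i A then ksgn k (insert i A - {k}) *
             lookup (\<phi> (insert i A - {k})) (m - single i 1 + single k 1) else 0)"
        if "i \<notin> A" "lookup m i > 0" for i
        unfolding lookup_\<eta> h_def Let_def shift[OF that] k_def ..
      show ?thesis
      proof (cases "k \<in> A")
        case False
        then have mk: "lookup m k > 0" using k by (simp add: a_def lookup_add)
        have "lookup (koszul \<eta> A) m = (\<Sum>i\<in>-A. if i = k then lookup (\<phi> A) m else 0)"
          unfolding lookup_koszul
        proof (intro sum.cong refl)
          fix i assume i: "i \<in> - A"
          have "m - single k 1 + single k 1 = m"
            using factor_out_variable[OF mk] by (simp add: add.commute)
          then show "(if 0 < lookup m i then ksgn i A * lookup (\<eta> (insert i A)) (m - single i 1) else 0)
              = (if i = k then lookup (\<phi> A) m else 0)"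
            using i False mk summand[of i] by (auto simp: ksgn_square simp flip: mult.assoc)
        qed
        then show ?thesis using False by simp
      next
        case True
        \<comment> \<open>The cycle condition at \<open>A - {k}\<close> expresses the wanted coefficient by those at the sets
          obtained from \<open>A\<close> by exchanging \<open>k\<close> for some \<open>i\<close>.\<close>
        define A' where "A' = A - {k}"
        have A: "A = insert k A'" "k \<notin> A'" using True by (auto simp: A'_def)
        let ?t = "\<lambda>i. if lookup m i > 0 then ksgn i A' * lookup (\<phi> (insert i A')) (m - single i 1 + single k 1) else 0"
        have eq: "- A' = insert k (- A)" using A by auto
        have "0 = lookup (koszul \<phi> A') (m + single k 1)"
          using cycle[OF True] by (simp add: A'_def)
        also have "\<dots> = ksgn k A' * lookup (\<phi> A) m + (\<Sum>i\<in>-A. ?t i)"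
          unfolding lookup_koszul eq
        proof (subst sum.insert)
          have *: "m + single k 1 - single i 1 = m - single i 1 + single k 1"
            if "i \<noteq> k" for i using that
            by (intro poly_mapping_eqI) (auto simp: lookup_add lookup_minus lookup_single when_def)
          have "(\<Sum>i\<in>- A. if 0 < lookup (m + single k 1) i
              then ksgn i A' * lookup (\<phi> (insert i A')) (m + single k 1 - single i 1) else 0) = (\<Sum>i\<in>-A. ?t i)"
            using A(1) by (intro sum.cong) (auto simp: lookup_add lookup_single when_def *)
          then show "(if 0 < lookup (m + single k 1) k
                then ksgn k A' * lookup (\<phi> (insert k A')) (m + single k 1 - single k 1) else 0) +
              (\<Sum>i\<in>- A. if 0 < lookup (m + single k 1) i
                then ksgn i A' * lookup (\<phi> (insert i A')) (m + single k 1 - single i 1) else 0) =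
              ksgn k A' * lookup (\<phi> A) m + (\<Sum>i\<in>-A. ?t i)"
            using A(1) by (simp add: lookup_add)
        qed (use True in auto)
        finally have "ksgn k A' * (ksgn k A' * lookup (\<phi> A) m + (\<Sum>i\<in>-A. ?t i)) = 0" by simp
        then have "lookup (\<phi> A) m = - (ksgn k A' * (\<Sum>i\<in>-A. ?t i))"
          by (simp add: distrib_left ksgn_square eq_neg_iff_add_eq_0 flip: mult.assoc)
        also have "\<dots> = (\<Sum>i\<in>-A. - (ksgn k A' * ?t i))"
          by (simp add: sum_distrib_left sum_negf)
        also have "\<dots> = lookup (koszul \<eta> A) m"
          unfolding lookup_koszul
        proof (intro sum.cong refl)
          fix i assume i: "i \<in> - A"
          then have i': "i \<noteq> k" "i \<notin> A'" "insert i A - {k} = insert i A'" using A by auto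
          have "ksgn i A * ksgn k (insert i A') = - (ksgn i A' * ksgn k A' :: 'k)"
            using ksgn_swap(1)[OF i'(1,2) A(2), where 'k = 'k] A(1) by simp
          then show "- (ksgn k A' * ?t i) =
              (if 0 < lookup m i then ksgn i A * lookup (\<eta> (insert i A)) (m - single i 1) else 0)"
            using i i'(3) True summand[of i] by (simp add: mult.commute mult.left_commute flip: mult.assoc)
        qed
        finally show ?thesis .
      qed
    qed
  qed
  then show ?thesis by blast
qed

section \<open>Koszul cycles of an ideal with a linear resolution\<close>

text \<open>
  To treat the augmentation like the other maps of the resolution, the ideal is placed in
  component 0 of a free module. Then \<open>aug_mat F 0\<close> is the augmentation, \<open>aug_mat F (Suc i)\<close> is the
  differential from \<open>F\<^sub>i\<^sub>+\<^sub>1\<close> to \<open>F\<^sub>i\<close>, and \<open>syzygies F s\<close>, the image of \<open>F\<^sub>s\<close>, is the ideal for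
  \<open>s = 0\<close> and a syzygy module for \<open>s > 0\<close>.
\<close>

definition matrix_map :: "nat \<Rightarrow> (nat \<Rightarrow> nat \<Rightarrow> ('n::finite, 'k::field) mpoly) \<Rightarrow> (nat \<Rightarrow> ('n, 'k) mpoly) \<Rightarrow> nat \<Rightarrow> ('n, 'k) mpoly"
  where "matrix_map r a u = (\<lambda>p. \<Sum>q<r. u q * a p q)"

definition aug_mat :: "('n::finite, 'k::field) resolution_data \<Rightarrow> nat \<Rightarrow> nat \<Rightarrow> nat \<Rightarrow> ('n, 'k) mpoly"
  where "aug_mat F s p q = (case s of 0 \<Rightarrow> if p = 0 then res_gen F q else 0
    | Suc i \<Rightarrow> if p < res_rank F i then res_mat F i p q else 0)"

definition target_deg :: "('n::finite, 'k::field) resolution_data \<Rightarrow> nat \<Rightarrow> nat \<Rightarrow> nat"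
  where "target_deg F s p = (case s of 0 \<Rightarrow> 0 | Suc i \<Rightarrow> res_deg F i p)"

definition syzygies :: "('n::finite, 'k::field) resolution_data \<Rightarrow> nat \<Rightarrow> (nat \<Rightarrow> ('n, 'k) mpoly) set"
  where "syzygies F s = matrix_map (res_rank F s) (aug_mat F s) ` free_mod (res_rank F s)"

lemma matrix_map_aug_mat_Suc: "matrix_map (res_rank F (Suc s)) (aug_mat F (Suc s)) = res_diff F s"
  by (auto simp: matrix_map_def aug_mat_def res_diff_def fun_eq_iff)

lemma matrix_map_aug_mat_0:
  "matrix_map (res_rank F 0) (aug_mat F 0) u = (\<lambda>p. if p = 0 then res_aug F u else 0)"
  by (auto simp: matrix_map_def aug_mat_def res_aug_def fun_eq_iff)

lemma syzygies_Suc: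
  assumes "graded_free_resolution I F"
  shows "syzygies F (Suc s) = {u \<in> free_mod (res_rank F s). matrix_map (res_rank F s) (aug_mat F s) u = (\<lambda>_. 0)}"
proof (cases s)
  case 0
  have "{u \<in> free_mod (res_rank F 0). res_aug F u = 0} = res_diff F 0 ` free_mod (res_rank F (Suc 0))"
    using assms by (simp add: graded_free_resolution_def One_nat_def)
  then show ?thesis
    unfolding 0 syzygies_def matrix_map_aug_mat_Suc matrix_map_aug_mat_0 by (auto simp: fun_eq_iff)
next
  case (Suc i)
  then show ?thesis
    unfolding syzygies_def Suc matrix_map_aug_mat_Suc
    using assms by (simp add: graded_free_resolution_def)
qed

lemma syzygies_0:
  assumes "graded_free_resolution I F"
  shows "syzygies F 0 = {u. u 0 \<in> I \<and> (\<forall>p>0. u p = 0)}"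
proof -
  have "I = res_aug F ` free_mod (res_rank F 0)"
    using assms by (simp add: graded_free_resolution_def)
  then show ?thesis
    unfolding syzygies_def matrix_map_aug_mat_0 by (auto simp: fun_eq_iff image_iff)
qed

lemma aug_mat_degree:
  assumes "graded_free_resolution I F" "q < res_rank F s" "m \<in> keys (aug_mat F s p q)"
  shows "mdeg m + target_deg F s p = res_deg F s q"
  using assms unfolding graded_free_resolution_def aug_mat_def target_deg_def graded_comp_def
  by (auto split: nat.splits if_splits)

lemma mdeg_add [simp]: "mdeg (a + b) = mdeg a + mdeg b"
  by (simp add: mdeg_eq_weighted_degree)

lemma mdeg_single [simp]: "mdeg (single i c) = c"
  by (simp add: mdeg_eq_weighted_degree)

lemma split_support:
  fixes f :: "('n::finite, 'k::field) mpoly"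
  obtains g h where "f = g + h" "keys g \<subseteq> Q" "keys h \<subseteq> - Q"
proof -
  define p where "p V = Abs_poly_mapping (\<lambda>m. if m \<in> V then lookup f m else 0)" for V
  have lookup_p: "lookup (p V) = (\<lambda>m. if m \<in> V then lookup f m else 0)" for V
    unfolding p_def
    by (intro Abs_poly_mapping_inverse CollectI finite_subset[OF _ finite_keys[of f]])
      (auto simp: in_keys_iff)
  show ?thesis
  proof (rule that)
    show "f = p Q + p (- Q)"
      by (rule poly_mapping_eqI) (simp add: lookup_add lookup_p)
    show "keys (p Q) \<subseteq> Q" "keys (p (- Q)) \<subseteq> - Q"
      by (auto simp: in_keys_iff lookup_p split: if_splits)
  qed
qed

text \<open>
  The component of degree \<open>d\<close> of any preimage is a preimage, because the maps are homogeneous.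
\<close>

lemma homogeneous_lift:
  assumes F: "graded_free_resolution I F" and z: "z \<in> syzygies F s"
    and hom: "\<And>p m. m \<in> keys (z p) \<Longrightarrow> mdeg m + target_deg F s p = d"
  shows "\<exists>u\<in>free_mod (res_rank F s). matrix_map (res_rank F s) (aug_mat F s) u = z \<and>
    (\<forall>q. \<forall>m\<in>keys (u q). mdeg m + res_deg F s q = d)"
proof -
  let ?r = "res_rank F s" and ?a = "aug_mat F s"
  obtain u where u: "u \<in> free_mod ?r" "z = matrix_map ?r ?a u"
    using z by (auto simp: syzygies_def)
  have "\<exists>g h. u q = g + h \<and> keys g \<subseteq> {m. mdeg m + res_deg F s q = d}
      \<and> keys h \<subseteq> - {m. mdeg m + res_deg F s q = d}" for q
    by (rule split_support[of "u q" "{m. mdeg m + res_deg F s q = d}"]) blast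
  then obtain g h where gh: "\<And>q. u q = g q + h q"
    "\<And>q. keys (g q) \<subseteq> {m. mdeg m + res_deg F s q = d}"
    "\<And>q. keys (h q) \<subseteq> - {m. mdeg m + res_deg F s q = d}" by metis
  define g' where "g' q = (if q < ?r then g q else 0)" for q
  have "(\<Sum>q<?r. g q * ?a p q) = z p" for p
  proof -
    let ?X = "\<Sum>q<?r. g q * ?a p q" and ?Y = "\<Sum>q<?r. h q * ?a p q"
    have sum: "z p = ?X + ?Y"
      by (simp add: u(2) matrix_map_def gh(1) algebra_simps sum.distrib)
    have X: "mdeg m + target_deg F s p = d" if m: "m \<in> keys ?X" for m
    proof -
      obtain q where q: "q < ?r" "m \<in> keys (g q * ?a p q)"
        using m keys_sum[of "\<lambda>q. g q * ?a p q" "{..<?r}"] by auto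
      then obtain b c where "b \<in> keys (g q)" "c \<in> keys (?a p q)" "m = b + c"
        using keys_mult[of "g q" "?a p q"] by auto
      then show ?thesis using gh(2)[of q] aug_mat_degree[OF F q(1), of c p] by auto
    qed
    have Y: "mdeg m + target_deg F s p \<noteq> d" if m: "m \<in> keys ?Y" for m
    proof -
      obtain q where q: "q < ?r" "m \<in> keys (h q * ?a p q)"
        using m keys_sum[of "\<lambda>q. h q * ?a p q" "{..<?r}"] by auto
      then obtain b c where "b \<in> keys (h q)" "c \<in> keys (?a p q)" "m = b + c"
        using keys_mult[of "h q" "?a p q"] by auto
      then show ?thesis using gh(3)[of q] aug_mat_degree[OF F q(1), of c p] by auto
    qed
    have "keys ?Y \<subseteq> keys (z p) \<union> keys ?X"
      using sum keys_diff[of "z p" ?X] by simp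
    then have "keys ?Y = {}" using X Y hom by blast
    then show ?thesis using sum by simp
  qed
  then have "matrix_map ?r ?a g' = z" by (simp add: matrix_map_def g'_def fun_eq_iff)
  moreover have "g' \<in> free_mod ?r" by (simp add: free_mod_def g'_def)
  moreover have "\<forall>q. \<forall>m\<in>keys (g' q). mdeg m + res_deg F s q = d"
    using gh(2) by (auto simp: g'_def)
  ultimately show ?thesis by blast
qed

lemma koszul_matrix_map:
  "matrix_map r a (\<lambda>q. koszul (\<lambda>B. u B q) A) p = koszul (\<lambda>B. matrix_map r a (u B) p) A"
  unfolding matrix_map_def by (simp add: koszul_linear_combination)

lemma keys_koszul:
  assumes "m \<in> keys (koszul \<phi> A)"
  obtains i m' where "i \<notin> A" "m' \<in> keys (\<phi> (insert i A))" "m = single i 1 + m'"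
proof -
  obtain i where "i \<notin> A" "m \<in> keys (single (single i 1) (ksgn i A) * \<phi> (insert i A))"
    using assms keys_sum[of "\<lambda>i. single (single i 1) (ksgn i A) * \<phi> (insert i A)" "-A"]
    by (auto simp: koszul_def)
  then show ?thesis using that by (auto simp: keys_single_times)
qed

lemma koszul_free_mod_boundary:
  fixes u :: "'n::finite set \<Rightarrow> nat \<Rightarrow> ('n, 'k::field) mpoly"
  assumes "\<And>A. card A = i \<Longrightarrow> u A \<in> free_mod r"
    and "\<And>A q. card A = i \<Longrightarrow> q < r \<Longrightarrow>
      (\<forall>j\<in>A. koszul (\<lambda>B. u B q) (A - {j}) = 0) \<and> (A = {} \<longrightarrow> lookup (u {} q) 0 = 0)"
  obtains v where "\<And>B. v B \<in> free_mod r" "\<And>A q. card A = i \<Longrightarrow> u A q = koszul (\<lambda>B. v B q) A"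
proof -
  have "\<exists>\<eta>. \<forall>A. (\<forall>j\<in>A. koszul (\<lambda>B. u B q) (A - {j}) = 0) \<and> (A = {} \<longrightarrow> lookup (u {} q) 0 = 0)
      \<longrightarrow> u A q = koszul \<eta> A" for q
    using koszul_exact[of "\<lambda>B. u B q"] .
  then obtain \<eta> where \<eta>: "\<And>A q. (\<forall>j\<in>A. koszul (\<lambda>B. u B q) (A - {j}) = 0) \<and> (A = {} \<longrightarrow> lookup (u {} q) 0 = 0)
      \<Longrightarrow> u A q = koszul (\<eta> q) A" by metis
  show ?thesis
  proof
    show "(\<lambda>q. if q < r then \<eta> q B else 0) \<in> free_mod r" for B by (simp add: free_mod_def)
    show "u A q = koszul (\<lambda>B. if q < r then \<eta> q B else 0) A" if "card A = i" for A q
      using assms(2)[OF that, of q] \<eta>[of A q] assms(1)[OF that] by (cases "q < r") (auto simp: free_mod_def)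
  qed
qed

text \<open>
  Dimension shifting, by induction on the homological degree \<open>i\<close> for all syzygy modules \<open>M\<^sub>s\<close> at
  once. In degree 0, a form in \<open>M\<^sub>s\<close> of degree greater than those of the generators is a combination
  of the generators with coefficients in the irrelevant ideal. In degree \<open>i + 1\<close>, lift the cycle to a
  chain \<open>z\<close> in \<open>F\<^sub>s\<close>. Its differential is a cycle in \<open>M\<^sub>s\<^sub>+\<^sub>1\<close> of homological degree \<open>i\<close> and of the same
  total degree \<open>d\<close>, so it is the differential of a chain \<open>w\<close> in \<open>M\<^sub>s\<^sub>+\<^sub>1\<close>. Now \<open>z - w\<close> is a cycle in
  the free module \<open>F\<^sub>s\<close>, hence a boundary; its image in \<open>M\<^sub>s\<close> is the given cycle, because \<open>w\<close> maps
  to 0.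
\<close>

lemma koszul_syzygies_boundary:
  fixes I :: "('n::finite, 'k::field) mpoly set"
  assumes F: "graded_free_resolution I F"
    and lin: "\<And>i q. q < res_rank F i \<Longrightarrow> res_deg F i q \<le> i + t"
    and "\<And>A. card A = i \<Longrightarrow> \<Phi> A \<in> syzygies F s"
    and "\<And>A p m. card A = i \<Longrightarrow> m \<in> keys (\<Phi> A p) \<Longrightarrow> mdeg m + target_deg F s p + i = d"
    and "\<And>A p. Suc (card A) = i \<Longrightarrow> koszul (\<lambda>B. \<Phi> B p) A = 0"
    and "i + s + t < d"
  shows "\<exists>w. (\<forall>A. card A = Suc i \<longrightarrow> w A \<in> syzygies F s) \<and>
    (\<forall>A p. card A = i \<longrightarrow> \<Phi> A p = koszul (\<lambda>B. w B p) A)"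
  using assms(3-)
proof (induction i arbitrary: s \<Phi>)
  case 0
  let ?r = "res_rank F s" and ?a = "aug_mat F s"
  obtain u where u: "u \<in> free_mod ?r" "matrix_map ?r ?a u = \<Phi> {}"
    "\<And>q m. m \<in> keys (u q) \<Longrightarrow> mdeg m + res_deg F s q = d"
    using homogeneous_lift[OF F, of "\<Phi> {}" s d] 0(1)[of "{}"] 0(2)[of "{}"] by auto
  have const: "lookup (u q) 0 = 0" if "q < ?r" for q
  proof (rule ccontr)
    assume "lookup (u q) 0 \<noteq> 0"
    then have "mdeg (0 :: 'n \<Rightarrow>\<^sub>0 nat) + res_deg F s q = d" using u(3) by (simp add: in_keys_iff)
    then show False using lin[OF that] 0(4) by (simp add: mdeg_def)
  qed
  obtain v where v: "\<And>B. v B \<in> free_mod ?r" "\<And>A q. card A = 0 \<Longrightarrow> u q = koszul (\<lambda>B. v B q) A"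
    using koszul_free_mod_boundary[of 0 "\<lambda>_. u" ?r] u(1) const by (metis card_0_eq empty_iff finite)
  have "\<Phi> A p = koszul (\<lambda>B. matrix_map ?r ?a (v B) p) A" if "card A = 0" for A p
  proof -
    have "A = {}" using that by simp
    have "\<Phi> {} p = matrix_map ?r ?a (\<lambda>q. koszul (\<lambda>B. v B q) {}) p"
      using u(2) v(2)[of "{}"] by (simp add: fun_eq_iff matrix_map_def)
    then show ?thesis unfolding koszul_matrix_map \<open>A = {}\<close> .
  qed
  moreover have "matrix_map ?r ?a (v B) \<in> syzygies F s" for B
    unfolding syzygies_def using v(1) by blast
  ultimately show ?case by (intro exI[of _ "\<lambda>B. matrix_map ?r ?a (v B)"]) blast
next
  case (Suc i)
  let ?r = "res_rank F s" and ?a = "aug_mat F s"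
  have "\<exists>u\<in>free_mod ?r. matrix_map ?r ?a u = \<Phi> A \<and>
      (\<forall>q. \<forall>m\<in>keys (u q). mdeg m + res_deg F s q = d - Suc i)" if "card A = Suc i" for A
  proof (rule homogeneous_lift[OF F])
    show "\<Phi> A \<in> syzygies F s" using Suc.prems(1) that .
    show "mdeg m + target_deg F s p = d - Suc i" if "m \<in> keys (\<Phi> A p)" for p m
      using Suc.prems(2)[OF \<open>card A = Suc i\<close> that] by simp
  qed
  then obtain z where z: "\<And>A. card A = Suc i \<Longrightarrow> z A \<in> free_mod ?r"
    "\<And>A. card A = Suc i \<Longrightarrow> matrix_map ?r ?a (z A) = \<Phi> A"
    "\<And>A q m. card A = Suc i \<Longrightarrow> m \<in> keys (z A q) \<Longrightarrow> mdeg m + res_deg F s q = d - Suc i"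
    by metis
  define y where "y A q = koszul (\<lambda>B. z B q) A" for A q
  have "\<exists>w. (\<forall>A. card A = Suc i \<longrightarrow> w A \<in> syzygies F (Suc s)) \<and>
    (\<forall>A p. card A = i \<longrightarrow> y A p = koszul (\<lambda>B. w B p) A)"
  proof (rule Suc.IH)
    fix A :: "'n set" assume A: "card A = i"
    have "y A \<in> free_mod ?r"
      using z(1) A by (auto simp: y_def free_mod_def koszul_def intro!: sum.neutral)
    moreover have "matrix_map ?r ?a (y A) p = 0" for p
    proof -
      have "matrix_map ?r ?a (y A) p = koszul (\<lambda>B. matrix_map ?r ?a (z B) p) A"
        unfolding y_def koszul_matrix_map ..
      also have "\<dots> = koszul (\<lambda>B. \<Phi> B p) A"
        by (rule koszul_cong) (simp add: z(2) A)
      also have "\<dots> = 0" using Suc.prems(3) A by simp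
      finally show ?thesis .
    qed
    ultimately show "y A \<in> syzygies F (Suc s)" by (simp add: syzygies_Suc[OF F] fun_eq_iff)
  next
    fix A p and m :: "'n \<Rightarrow>\<^sub>0 nat" assume A: "card A = i" and m: "m \<in> keys (y A p)"
    obtain j m' where j: "j \<notin> A" "m' \<in> keys (z (insert j A) p)" "m = single j 1 + m'"
      using m unfolding y_def by (rule keys_koszul)
    have "mdeg m' + res_deg F s p = d - Suc i" using z(3)[of "insert j A" m' p] j A by simp
    then show "mdeg m + target_deg F (Suc s) p + i = d"
      using j(3) Suc.prems(4) by (simp add: target_deg_def)
  next
    fix A :: "'n set" and p
    show "koszul (\<lambda>B. y B p) A = 0"
      unfolding y_def using koszul_koszul[of "\<lambda>B. z B p" A] by simp
  qed (use Suc.prems(4) in simp)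
  then obtain w where w: "\<And>A. card A = Suc i \<Longrightarrow> w A \<in> syzygies F (Suc s)"
    "\<And>A p. card A = i \<Longrightarrow> y A p = koszul (\<lambda>B. w B p) A" by blast
  define x where "x B q = z B q - w B q" for B q
  obtain v where v: "\<And>B. v B \<in> free_mod ?r" "\<And>A q. card A = Suc i \<Longrightarrow> x A q = koszul (\<lambda>B. v B q) A"
  proof (rule koszul_free_mod_boundary[of "Suc i" x ?r])
    fix A :: "'n set" assume A: "card A = Suc i"
    show "x A \<in> free_mod ?r"
      using z(1)[OF A] w(1)[OF A] by (simp add: syzygies_Suc[OF F] x_def free_mod_def)
    fix q
    have "koszul (\<lambda>B. x B q) (A - {j}) = 0" if "j \<in> A" for j
    proof -
      have "card (A - {j}) = i" using A that by simp
      then show ?thesis using w(2)[of "A - {j}" q] by (simp add: x_def koszul_diff y_def)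
    qed
    then show "(\<forall>j\<in>A. koszul (\<lambda>B. x B q) (A - {j}) = 0) \<and> (A = {} \<longrightarrow> lookup (x {} q) 0 = 0)"
      using A by auto
  qed (rule that)
  have "\<Phi> A p = koszul (\<lambda>B. matrix_map ?r ?a (v B) p) A" if A: "card A = Suc i" for A p
  proof -
    have "matrix_map ?r ?a (w A) p = 0" using w(1)[OF A] by (simp add: syzygies_Suc[OF F])
    moreover have "matrix_map ?r ?a (x A) p = matrix_map ?r ?a (z A) p - matrix_map ?r ?a (w A) p"
      by (simp add: matrix_map_def x_def algebra_simps sum_subtractf)
    ultimately have "\<Phi> A p = matrix_map ?r ?a (x A) p" using z(2)[OF A] by simp
    also have "\<dots> = matrix_map ?r ?a (\<lambda>q. koszul (\<lambda>B. v B q) A) p"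
      by (simp add: matrix_map_def v(2)[OF A])
    finally show ?thesis unfolding koszul_matrix_map .
  qed
  moreover have "matrix_map ?r ?a (v B) \<in> syzygies F s" for B
    unfolding syzygies_def using v(1) by blast
  ultimately show ?case by (intro exI[of _ "\<lambda>B. matrix_map ?r ?a (v B)"]) blast
qed

lemma koszul_ideal_boundary:
  fixes I :: "('n::finite, 'k::field) mpoly set"
  assumes F: "graded_free_resolution I F"
    and lin: "\<And>i q. q < res_rank F i \<Longrightarrow> res_deg F i q \<le> i + t"
    and mem: "\<And>A. card A = i \<Longrightarrow> \<phi> A \<in> I"
    and hom: "\<And>A. card A = i \<Longrightarrow> \<phi> A \<in> graded_comp d" "t < d"
    and cycle: "\<And>A. Suc (card A) = i \<Longrightarrow> koszul \<phi> A = 0"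
  obtains w where "\<And>A. card A = Suc i \<Longrightarrow> w A \<in> I" "\<And>A. card A = i \<Longrightarrow> \<phi> A = koszul w A"
proof -
  let ?\<Phi> = "\<lambda>A p. if p = 0 then \<phi> A else 0"
  have "\<exists>w. (\<forall>A. card A = Suc i \<longrightarrow> w A \<in> syzygies F 0) \<and>
    (\<forall>A p. card A = i \<longrightarrow> ?\<Phi> A p = koszul (\<lambda>B. w B (p::nat)) A)"
  proof (rule koszul_syzygies_boundary[OF F lin])
    show "mdeg m + target_deg F 0 p + i = d + i" if "card A = i" "m \<in> keys (?\<Phi> A p)" for A p m
      using hom(1)[OF that(1)] that(2) by (auto simp: graded_comp_def target_deg_def split: if_splits)
    show "koszul (\<lambda>B. ?\<Phi> B p) A = 0" if "Suc (card A) = i" for A and p :: nat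
      using cycle[OF that] by (cases "p = 0") auto
  qed (use mem hom(2) in \<open>auto simp: syzygies_0[OF F]\<close>)
  then obtain w where w: "\<And>A. card A = Suc i \<Longrightarrow> w A \<in> syzygies F 0"
    "\<And>A p. card A = i \<Longrightarrow> ?\<Phi> A p = koszul (\<lambda>B. w B (p::nat)) A" by blast
  show ?thesis
  proof (rule that)
    show "w A 0 \<in> I" if "card A = Suc i" for A using w(1)[OF that] by (simp add: syzygies_0[OF F])
    show "\<phi> A = koszul (\<lambda>B. w B 0) A" if "card A = i" for A using w(2)[OF that, of 0] by simp
  qed
qed

section \<open>Ideals generated by quadratic monomials\<close>

definition edge :: "('n::finite, 'k::field) mpoly set \<Rightarrow> 'n \<Rightarrow> 'n \<Rightarrow> bool"
  where "edge I a b \<longleftrightarrow> monomial (single a 1 + single b 1) \<in> I"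

lemma edge_sym: "edge I a b \<longleftrightarrow> edge I b a"
  by (simp add: edge_def add.commute)

lemma exponent_mdeg_Suc:
  assumes "mdeg m = Suc d"
  obtains i r where "m = single i 1 + r" "mdeg r = d"
proof -
  have "m = 0 \<or> (\<exists>i r. m = single i 1 + r)"
    by (induction m rule: exponent_induct) auto
  moreover have "m \<noteq> 0" using assms by (auto simp: mdeg_def)
  ultimately show ?thesis using that assms by auto
qed

lemma exponent_mdeg_2:
  assumes "mdeg m = 2"
  obtains a b where "m = single a 1 + single b 1"
proof -
  obtain a r where r: "m = single a 1 + r" "mdeg r = 1"
    using exponent_mdeg_Suc[of m 1] assms by (auto simp: numeral_2_eq_2 One_nat_def)
  then obtain b r' where r': "r = single b 1 + r'" "mdeg r' = 0"
    using exponent_mdeg_Suc[of r 0] by (auto simp: One_nat_def)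
  then have "r' = 0" by (intro poly_mapping_eqI) (simp add: mdeg_def)
  then show ?thesis using that r r' by simp
qed

text \<open>
  An equigenerated ideal is generated in its initial degree; for a monomial ideal the monomials of
  the generators are generators too.
\<close>

lemma quadratic_monomial_ideal:
  fixes I :: "('n::finite, 'k::field) mpoly set"
  assumes I: "monomial_ideal I" and gen: "equigenerated I" and ne: "I \<noteq> {0}" and \<alpha>: "alpha I = 2"
  shows "f \<in> I \<Longrightarrow> m \<in> keys f \<Longrightarrow> \<exists>a b r. m = r + (single a 1 + single b 1) \<and> edge I a b"
    and "\<exists>a b. edge I a b"
proof -
  note ideal = monomial_ideal_ideal[OF I]
  obtain d G where G: "G \<subseteq> graded_comp d" "I = Idl\<^bsub>poly_ring\<^esub> G"
    using gen by (auto simp: equigenerated_def)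
  let ?U = "{m. \<exists>m' r. m = r + m' \<and> mdeg m' = d \<and> (monomial m' :: ('n, 'k) mpoly) \<in> I}"
  have "Idl\<^bsub>poly_ring\<^esub> G \<subseteq> supported_on ?U"
  proof (rule Idl_subset)
    show "ideal (supported_on ?U) (poly_ring :: ('n, 'k) mpoly ring)"
      by (rule ideal_supported_on) (auto, metis add.assoc)
    show "G \<subseteq> supported_on ?U"
    proof
      fix g assume g: "g \<in> G"
      then have "g \<in> I" using subset_Idl G(2) by blast
      then have "\<forall>m\<in>keys g. monomial m \<in> I" using mem_monomial_ideal_iff[OF I] by blast
      moreover have "\<forall>m\<in>keys g. mdeg m = d" using g G(1) by (auto simp: graded_comp_def)
      ultimately have "\<forall>m\<in>keys g. m = 0 + m \<and> mdeg m = d \<and> monomial m \<in> I" by simp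
      then show "g \<in> supported_on ?U"
        unfolding supported_on_def by blast
    qed
  qed
  then have div: "\<exists>m' r. m = r + m' \<and> mdeg m' = d \<and> (monomial m' :: ('n, 'k) mpoly) \<in> I"
    if "f \<in> I" "m \<in> keys f" for f m
    using that by (auto simp: supported_on_def G(2)[symmetric])
  have mono_ne: "monomial m \<noteq> (0 :: ('n, 'k) mpoly)" for m
    by (metis insert_not_empty keys_monomial keys_zero)
  have mono_deg: "monomial m \<in> (graded_comp (mdeg m) :: ('n, 'k) mpoly set)" for m
    by (simp add: graded_comp_def)
  obtain g where g: "g \<in> I" "g \<noteq> 0" using ne ideal_zero[OF ideal] by auto
  then obtain n where "n \<in> keys g" by (metis keys_eq_empty ex_in_conv)
  then have "monomial n \<in> I" using g(1) mem_monomial_ideal_iff[OF I] by blast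
  then have ex: "\<exists>d. \<exists>f\<in>I - {0}. f \<in> graded_comp d" using mono_ne mono_deg by blast
  have "\<exists>f\<in>I - {0}. f \<in> graded_comp 2"
    using LeastI_ex[OF ex] \<alpha> by (simp add: alpha_def)
  then obtain h where h: "h \<in> I" "h \<noteq> 0" "h \<in> graded_comp 2" by blast
  then obtain l where l: "l \<in> keys h" by (metis keys_eq_empty ex_in_conv)
  have "mdeg l = 2" using h l by (simp add: graded_comp_def)
  moreover obtain m' r where m': "l = r + m'" "mdeg m' = d" "monomial m' \<in> I"
    using div[OF h(1) l] by blast
  ultimately have "d \<le> 2" by simp
  moreover have "alpha I \<le> d"
    unfolding alpha_def by (rule Least_le) (use m' mono_ne mono_deg[of m'] in auto)
  ultimately have d: "d = 2" using \<alpha> by simp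
  have quad: "\<exists>a b r. m = r + (single a 1 + single b 1) \<and> edge I a b" if fm: "f \<in> I" "m \<in> keys f" for f m
  proof -
    obtain m' r where m': "m = r + m'" "mdeg m' = 2" "(monomial m' :: ('n, 'k) mpoly) \<in> I"
      using div[OF fm] d by blast
    obtain a b where "m' = single a 1 + single b 1" using m'(2) by (rule exponent_mdeg_2)
    then show ?thesis using m' by (auto simp: edge_def)
  qed
  then show "f \<in> I \<Longrightarrow> m \<in> keys f \<Longrightarrow> \<exists>a b r. m = r + (single a 1 + single b 1) \<and> edge I a b" .
  show "\<exists>a b. edge I a b" using quad[OF h(1) l] by blast
qed

text \<open>
  The regularity \<open>t\<close> is an infimum, so the supremum belonging to some resolution is below
  \<open>t + 1\<close>. It bounds the differences \<open>res_deg F i q - i\<close>, which are integers.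
\<close>

lemma linear_resolution_bounded:
  assumes "has_linear_resolution I" "alpha I = t"
  obtains F where "graded_free_resolution I F" "\<And>i q. q < res_rank F i \<Longrightarrow> res_deg F i q \<le> i + t"
proof -
  have "reg I < ereal (real t + 1)" using assms by (simp add: has_linear_resolution_def)
  then obtain F where F: "minimal_graded_free_resolution I F"
    "Sup {ereal (real j - real i) | i j. graded_betti F i j \<noteq> 0} < ereal (real t + 1)"
    unfolding reg_def INF_less_iff by auto
  show ?thesis
  proof (rule that)
    show "graded_free_resolution I F" using F(1) by (simp add: minimal_graded_free_resolution_def)
    fix i q assume "q < res_rank F i"
    then have "graded_betti F i (res_deg F i q) \<noteq> 0"
      by (auto simp: graded_betti_def)
    then have "ereal (real (res_deg F i q) - real i) \<le> Sup {ereal (real j - real i) | i j. graded_betti F i j \<noteq> 0}"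
      by (intro Sup_upper) blast
    then have "ereal (real (res_deg F i q) - real i) < ereal (real t + 1)"
      using F(2) by (rule le_less_trans)
    then show "res_deg F i q \<le> i + t" by simp
  qed
qed

lemma no_edge_coefficient:
  assumes "monomial_ideal I" "f \<in> I" "\<not> edge I a b"
  shows "lookup f (single a 1 + single b 1) = 0"
  using assms mem_monomial_ideal_iff[OF assms(1), of f] unfolding edge_def by (metis in_keys_iff)

section \<open>Obstructions to a linear resolution\<close>

text \<open>
  Otherwise the syzygy \<open>x \<cdot> (x a b) = a \<cdot> (x\<^sup>2 b)\<close> would be a Koszul cycle of multidegree
  \<open>x\<^sup>2 a b\<close>. In this multidegree the coefficient of a bounding chain at \<open>{x, a}\<close> would be a
  scalar multiple of \<open>x b\<close>, the one at \<open>{x, b}\<close> a scalar multiple of \<open>x a\<close>. Neither monomial is in \<open>I\<close>, so the cycle does not bound. The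
  case \<open>a = b\<close> is included.
\<close>

lemma loop_meets_edges:
  fixes I :: "('n::finite, 'k::field) mpoly set"
  assumes I: "monomial_ideal I" and F: "graded_free_resolution I F"
    and lin: "\<And>i q. q < res_rank F i \<Longrightarrow> res_deg F i q \<le> i + 2"
    and loop: "edge I x x" and ab: "edge I a b"
  shows "edge I x a \<or> edge I x b"
proof (rule ccontr)
  assume "\<not> ?thesis"
  then have no: "\<not> edge I x a" "\<not> edge I x b" by auto
  then have x: "x \<noteq> a" "x \<noteq> b" using loop by auto
  note ideal = monomial_ideal_ideal[OF I]
  let ?e = "\<lambda>i. single i (1 :: nat)"
  define \<phi> :: "'n set \<Rightarrow> ('n, 'k) mpoly" where "\<phi> A = (if A = {x} then monomial (?e x + ?e a + ?e b)
      else if A = {a} then - monomial (?e x + ?e x + ?e b) else 0)" for A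
  have mem: "\<phi> A \<in> I" for A
  proof -
    have "monomial (?e x + ?e a + ?e b) \<in> I"
      using ideal_mult[OF ideal, of "monomial (?e a + ?e b)" "monomial (?e x)"] ab
      by (simp add: edge_def monomial_times_monomial add.assoc)
    moreover have "- monomial (?e x + ?e x + ?e b) \<in> I"
      using ideal_mult[OF ideal, of "monomial (?e x + ?e x)" "- monomial (?e b)"] loop
      by (simp add: edge_def monomial_times_monomial add.commute)
    ultimately show ?thesis using ideal_zero[OF ideal] by (simp add: \<phi>_def)
  qed
  have hom: "\<phi> A \<in> graded_comp 3" for A
    by (auto simp: \<phi>_def graded_comp_def split: if_splits)
  have "koszul \<phi> {} = 0"
  proof -
    have "koszul \<phi> {} = (\<Sum>i\<in>{x, a}. monomial (?e i) * \<phi> {i})"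
      unfolding koszul_def by (rule sum.mono_neutral_cong_right) (auto simp: \<phi>_def ksgn_def monomial_def)
    then show ?thesis using x by (simp add: \<phi>_def monomial_times_monomial ac_simps)
  qed
  then have cycle: "koszul \<phi> A = 0" if "Suc (card A) = 1" for A using that by (simp add: One_nat_def)
  obtain w where w: "\<And>A. card A = Suc 1 \<Longrightarrow> w A \<in> I" "\<And>A. card A = 1 \<Longrightarrow> \<phi> A = koszul w A"
    by (rule koszul_ideal_boundary[of I F 2 1 \<phi> 3, OF F lin mem hom _ cycle]) auto
  let ?m = "?e x + ?e a + ?e b"
  have "1 = lookup (\<phi> {x}) ?m" by (simp add: \<phi>_def monomial_def)
  also have "\<phi> {x} = koszul w {x}" by (rule w(2)) simp
  also have "lookup (koszul w {x}) ?m = 0"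
    unfolding lookup_koszul
  proof (intro sum.neutral ballI)
    fix i assume i: "i \<in> - {x}"
    have "lookup (w {i, x}) (?m - ?e i) = 0" if "lookup ?m i > 0"
    proof -
      have mem: "w {i, x} \<in> I" using i by (intro w(1)) (simp add: One_nat_def)
      have "i = a \<or> i = b" using i that by (auto simp: lookup_add lookup_single when_def split: if_splits)
      then show ?thesis
      proof
        assume "i = a"
        then have "?m - ?e i = ?e x + ?e b"
          by (intro poly_mapping_eqI) (simp add: lookup_add lookup_minus)
        then show ?thesis using no_edge_coefficient[OF I mem no(2)] by simp
      next
        assume "i = b"
        then have "?m - ?e i = ?e x + ?e a"
          by (intro poly_mapping_eqI) (simp add: lookup_add lookup_minus)
        then show ?thesis using no_edge_coefficient[OF I mem no(1)] by simp
      qed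
    qed
    then show "(if 0 < lookup ?m i then ksgn i {x} * lookup (w (insert i {x})) (?m - ?e i) else 0) = 0"
      by simp
  qed
  finally show False by simp
qed

text \<open>
  In the squarefree multidegree \<open>W\<close>, replacing a set by its complement in \<open>W\<close> turns Koszul chains into
  cochains of the full simplex on \<open>W\<close>, and the differential into the coboundary. Let \<open>\<psi>\<close> be the
  cochain that is 1 on \<open>pq\<close> and 0 on the other pairs. Its coboundary lives on triples
  \<open>{p, q, t}\<close>, whose monomials are in \<open>I\<close> by \<open>cover\<close>, so it is the coboundary of some \<open>w\<close> with
  coefficients in \<open>I\<close>, that is, of a cochain \<open>w\<close> that vanishes on the pairs outside the graph. The
  cocycle \<open>\<psi> - w\<close> is 1 on \<open>pq\<close> and 0 on all other pairs outside the graph. But a cocycle that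
  vanishes on two sides of a triangle vanishes on the third, so a path from \<open>p\<close> to \<open>q\<close> through such
  pairs would force it to vanish on \<open>pq\<close>.
\<close>

lemma coedge_separates:
  fixes I :: "('n::finite, 'k::field) mpoly set"
  assumes I: "monomial_ideal I" and F: "graded_free_resolution I F"
    and lin: "\<And>i q. q < res_rank F i \<Longrightarrow> res_deg F i q \<le> i + 2"
    and pq: "p \<in> W" "q \<in> W" "p \<noteq> q" "\<not> edge I p q"
    and cover: "\<And>t. t \<in> W - {p, q} \<Longrightarrow> edge I t p \<or> edge I t q"
  shows "(p, q) \<notin> {(a, b). a \<in> W \<and> b \<in> W \<and> a \<noteq> b \<and> \<not> edge I a b \<and> {a, b} \<noteq> {p, q}}\<^sup>*"
    (is "_ \<notin> ?R\<^sup>*")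
proof
  assume path: "(p, q) \<in> ?R\<^sup>*"
  note ideal = monomial_ideal_ideal[OF I]
  let ?e = "\<lambda>i. single i (1 :: nat)"
  have "W \<noteq> {p, q}"
  proof
    assume "W = {p, q}"
    then have "?R = {}" by auto
    then have "(p, q) \<in> {}\<^sup>*" using path by (simp only:)
    then show False using pq(3) by simp
  qed
  then obtain t where "t \<in> W - {p, q}" using pq by auto
  then have "card {p, q, t} \<le> card W" using pq by (intro card_mono) auto
  moreover have "card {p, q, t} = 3" using pq \<open>t \<in> W - {p, q}\<close> by auto
  ultimately obtain i where i: "card W = i + 3" by (metis add.commute le_Suc_ex)
  have card2: "card (W - {a, b}) = Suc i" if "a \<in> W" "b \<in> W" "a \<noteq> b" for a b
    using that i by (simp add: card_Diff_subset)
  have card3: "card (W - {a, b, c}) = i" if "a \<in> W" "b \<in> W" "c \<in> W" "a \<noteq> b" "b \<noteq> c" "a \<noteq> c" for a b c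
    using that i by (simp add: card_Diff_subset)
  define \<psi> :: "'n set \<Rightarrow> ('n, 'k) mpoly" where
    "\<psi> A = (if A = W - {p, q} then monomial (?e p + ?e q) else 0)" for A
  have mem: "koszul \<psi> A \<in> I" for A
    unfolding koszul_def
  proof (rule ideal_sum[OF ideal])
    fix t assume t: "t \<in> - A"
    show "single (?e t) (ksgn t A) * \<psi> (insert t A) \<in> I"
    proof (cases "insert t A = W - {p, q}")
      case True
      then have "t \<in> W - {p, q}" by auto
      from cover[OF this] show ?thesis
      proof
        assume "edge I t p"
        then have "single (?e q) (ksgn t A) * monomial (?e t + ?e p) \<in> I"
          using ideal_mult[OF ideal] by (auto simp: edge_def)
        then show ?thesis using True by (simp add: \<psi>_def monomial_def mult_single ac_simps)
      next
        assume "edge I t q"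
        then have "single (?e p) (ksgn t A) * monomial (?e t + ?e q) \<in> I"
          using ideal_mult[OF ideal] by (auto simp: edge_def)
        then show ?thesis using True by (simp add: \<psi>_def monomial_def mult_single ac_simps)
      qed
    qed (simp add: \<psi>_def ideal_zero[OF ideal])
  qed
  have hom: "koszul \<psi> A \<in> graded_comp 3" for A
    unfolding graded_comp_def
    by (auto elim!: keys_koszul simp: \<psi>_def split: if_splits)
  obtain w where w: "\<And>A. card A = Suc i \<Longrightarrow> w A \<in> I" "\<And>A. card A = i \<Longrightarrow> koszul \<psi> A = koszul w A"
    by (rule koszul_ideal_boundary[of I F 2 i "koszul \<psi>" 3, OF F lin mem hom _ koszul_koszul]) auto
  define \<theta> where "\<theta> = (\<lambda>B. \<psi> B - w B)"
  define g where "g a b = lookup (\<theta> (W - {a, b})) (?e a + ?e b)" for a b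
  have g_sym: "g a b = g b a" for a b by (simp add: g_def insert_commute add.commute)
  have g_edge: "lookup (w (W - {a, b})) (?e a + ?e b) = 0"
    if "a \<in> W" "b \<in> W" "a \<noteq> b" "\<not> edge I a b" for a b
    using w(1)[OF card2[OF that(1-3)]] no_edge_coefficient[OF I _ that(4)] by blast
  \<comment> \<open>The cocycle condition on the triangle \<open>{a, b, c}\<close>.\<close>
  have g_trans: "g a c = 0"
    if abc: "a \<in> W" "b \<in> W" "c \<in> W" "a \<noteq> b" "b \<noteq> c" "a \<noteq> c" and ab: "g a b = 0" and bc: "g b c = 0" for a b c
  proof -
    let ?A = "W - {a, b, c}" and ?m = "?e a + ?e b + ?e c"
    have sets: "insert a ?A = W - {b, c}" "insert b ?A = W - {a, c}" "insert c ?A = W - {a, b}"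
      using abc by auto
    have minus: "?m - ?e a = ?e b + ?e c" "?m - ?e b = ?e a + ?e c" "?m - ?e c = ?e a + ?e b"
      by (intro poly_mapping_eqI; simp add: lookup_add lookup_minus)+
    have pos: "lookup ?m a > 0" "lookup ?m b > 0" "lookup ?m c > 0"
      by (simp_all add: lookup_add)
    have "0 = lookup (koszul \<theta> ?A) ?m"
      using w(2)[OF card3[OF abc]] by (simp add: \<theta>_def koszul_diff)
    also have "\<dots> = (\<Sum>i\<in>{a, b, c}. ksgn i ?A * lookup (\<theta> (insert i ?A)) (?m - ?e i))"
      unfolding lookup_koszul
      by (rule sum.mono_neutral_cong_right)
        (use pos in \<open>auto simp: lookup_add lookup_single when_def split: if_splits\<close>)
    also have "\<dots> = ksgn a ?A * g b c + ksgn b ?A * g a c + ksgn c ?A * g a b"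
      using abc by (simp add: sets minus g_def)
    finally show ?thesis using ab bc by simp
  qed
  have "y = p \<or> g p y = 0" if "(p, y) \<in> ?R\<^sup>*" for y
    using that
  proof (induction rule: rtrancl_induct)
    case (step y z)
    then have yz: "y \<in> W" "z \<in> W" "y \<noteq> z" "\<not> edge I y z" "{y, z} \<noteq> {p, q}" by auto
    then have "W - {y, z} \<noteq> W - {p, q}" using pq by blast
    then have "g y z = 0" using g_edge[OF yz(1-4)] by (simp add: g_def \<theta>_def \<psi>_def lookup_minus)
    then show ?case
      using step.IH g_trans[of p y z] yz pq(1) by auto
  qed simp
  then have "g p q = 0" using path pq(3) by blast
  moreover have "g p q = 1"
    using g_edge[OF pq] by (simp add: g_def \<theta>_def \<psi>_def lookup_minus monomial_def)
  ultimately show False by simp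
qed

section \<open>Simplicial vertices\<close>

text \<open>
  Dirac's theorem that a chordal graph has a simplicial vertex not adjacent to a given vertex \<open>u\<close>,
  provided that \<open>u\<close> is not adjacent to every other vertex. Let \<open>C\<close> be a component of the
  non-neighbours of \<open>u\<close> and \<open>B\<close> the set of vertices outside \<open>C\<close> adjacent to \<open>C\<close>. All of \<open>B\<close> is
  adjacent to \<open>u\<close>, and \<open>B\<close> is a clique: for nonadjacent \<open>b\<^sub>1\<close> and \<open>b\<^sub>2\<close> in \<open>B\<close>, the edge from \<open>u\<close> to
  \<open>b\<^sub>1\<close> could be bypassed through \<open>b\<^sub>2\<close> and \<open>C\<close>, without forming a triangle. By induction on
  \<open>C \<union> B\<close>, which does not contain \<open>u\<close>, some vertex of \<open>C\<close> is simplicial in \<open>C \<union> B\<close>, hence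
  everywhere, since its neighbours all lie in \<open>C \<union> B\<close>.
\<close>

lemma simplicial_vertex:
  fixes H :: "'n::finite \<Rightarrow> 'n \<Rightarrow> bool"
  assumes sym: "\<And>a b. H a b \<Longrightarrow> H b a" and irrefl: "\<And>a. \<not> H a a"
    and chordal: "\<And>W p q. p \<in> W \<Longrightarrow> q \<in> W \<Longrightarrow> H p q \<Longrightarrow> (\<And>t. t \<in> W \<Longrightarrow> H t p \<Longrightarrow> \<not> H t q) \<Longrightarrow>
      (p, q) \<notin> {(a, b). a \<in> W \<and> b \<in> W \<and> H a b \<and> {a, b} \<noteq> {p, q}}\<^sup>*"
    and "u \<in> V" "v \<in> V" "v \<noteq> u" "\<not> H u v"
  shows "\<exists>s\<in>V. s \<noteq> u \<and> \<not> H s u \<and> (\<forall>a\<in>V. \<forall>b\<in>V. H s a \<longrightarrow> H s b \<longrightarrow> a \<noteq> b \<longrightarrow> H a b)"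
  using assms(4-)
proof (induction "card V" arbitrary: V u v rule: less_induct)
  case less
  define D where "D = {x \<in> V. x \<noteq> u \<and> \<not> H u x}"
  define C where "C = {c. (v, c) \<in> {(a, b). a \<in> D \<and> b \<in> D \<and> H a b}\<^sup>*}"
  define B where "B = {b \<in> V - C. \<exists>c\<in>C. H b c}"
  have vD: "v \<in> D" using less.prems by (simp add: D_def)
  have vC: "v \<in> C" by (simp add: C_def)
  have CD: "C \<subseteq> D"
  proof
    fix c assume "c \<in> C"
    then have "(v, c) \<in> {(a, b). a \<in> D \<and> b \<in> D \<and> H a b}\<^sup>*" by (simp add: C_def)
    then show "c \<in> D" by (induction rule: rtrancl_induct) (use vD in auto)
  qed
  have C_step: "b \<in> C" if "a \<in> C" "b \<in> D" "H a b" for a b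
    using that CD unfolding C_def by (auto intro: rtrancl_into_rtrancl)
  have uB: "H u b" if b: "b \<in> B" for b
  proof (rule ccontr)
    assume no: "\<not> H u b"
    obtain c where c: "c \<in> C" "H b c" using b by (auto simp: B_def)
    have "b \<noteq> u" using c CD by (auto simp: D_def)
    then have "b \<in> D" using b no by (auto simp: B_def D_def)
    then have "b \<in> C" using C_step c sym by blast
    then show False using b by (simp add: B_def)
  qed
  let ?Rc = "{(a, b). a \<in> C \<and> b \<in> C \<and> H a b}"
  have Rc: "(v, c) \<in> ?Rc\<^sup>*" if "c \<in> C" for c
  proof -
    have "(v, c) \<in> {(a, b). a \<in> D \<and> b \<in> D \<and> H a b}\<^sup>*" using that by (simp add: C_def)
    then have "c \<in> C \<and> (v, c) \<in> ?Rc\<^sup>*"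
    proof (induction rule: rtrancl_induct)
      case (step y z)
      then show ?case using C_step[of y z] by (auto intro: rtrancl_into_rtrancl)
    qed (simp add: vC)
    then show ?thesis ..
  qed
  have "sym ?Rc" using sym by (auto simp: sym_def)
  then have Rc_conn: "(c, c') \<in> ?Rc\<^sup>*" if "c \<in> C" "c' \<in> C" for c c'
    using Rc[OF that(1)] Rc[OF that(2)] by (meson rtrancl_trans sym_rtrancl symE)
  have B_clique: "H b1 b2" if b: "b1 \<in> B" "b2 \<in> B" "b1 \<noteq> b2" for b1 b2
  proof (rule ccontr)
    assume no: "\<not> H b1 b2"
    obtain c1 c2 where c: "c1 \<in> C" "H b1 c1" "c2 \<in> C" "H b2 c2" using b by (auto simp: B_def)
    let ?W = "insert u (insert b1 (insert b2 C))"
    let ?R = "{(a, b). a \<in> ?W \<and> b \<in> ?W \<and> H a b \<and> {a, b} \<noteq> {u, b1}}"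
    have u: "u \<notin> C" "u \<noteq> b1" "u \<noteq> b2" using CD uB[OF b(1)] uB[OF b(2)] irrefl by (auto simp: D_def)
    have "?Rc \<subseteq> ?R" using u by (auto simp: doubleton_eq_iff)
    then have "(c2, c1) \<in> ?R\<^sup>*" using Rc_conn[OF c(3,1)] rtrancl_mono by blast
    moreover have "(u, b2) \<in> ?R" using uB[OF b(2)] b(3) u by auto
    moreover have "(b2, c2) \<in> ?R" using c u by (auto simp: doubleton_eq_iff)
    moreover have "(c1, b1) \<in> ?R" using c u sym by (auto simp: doubleton_eq_iff)
    ultimately have "(u, b1) \<in> ?R\<^sup>*"
      by (meson converse_rtrancl_into_rtrancl rtrancl_into_rtrancl)
    moreover have "(u, b1) \<notin> ?R\<^sup>*"
    proof (rule chordal)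
      show "H u b1" using uB[OF b(1)] .
      fix t assume t: "t \<in> ?W" "H t u"
      then have "t \<in> {b1, b2}" using CD irrefl sym by (auto simp: D_def)
      then show "\<not> H t b1" using no irrefl sym by auto
    qed auto
    ultimately show False by blast
  qed
  let ?V = "C \<union> B"
  have "?V \<subset> V" using CD uB less.prems(1) irrefl by (auto simp: D_def B_def)
  then have smaller: "card ?V < card V" by (simp add: psubset_card_mono)
  have "\<exists>s\<in>C. \<forall>a\<in>?V. \<forall>b\<in>?V. H s a \<longrightarrow> H s b \<longrightarrow> a \<noteq> b \<longrightarrow> H a b"
  \<comment> \<open>A simplicial vertex that is not adjacent to some vertex of the clique \<open>B\<close> is outside \<open>B\<close>. If
    every vertex of \<open>B\<close> is adjacent to all others, any failure of adjacency in \<open>C \<union> B\<close> takes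
    place inside \<open>C\<close>.\<close>
  proof (cases "\<exists>b\<in>B. \<exists>x\<in>?V. x \<noteq> b \<and> \<not> H b x")
    case True
    then obtain b x where b: "b \<in> B" "x \<in> ?V" "x \<noteq> b" "\<not> H b x" by blast
    then obtain s where "s \<in> ?V" "s \<noteq> b" "\<not> H s b"
      "\<forall>a\<in>?V. \<forall>b\<in>?V. H s a \<longrightarrow> H s b \<longrightarrow> a \<noteq> b \<longrightarrow> H a b"
      using less.hyps[OF smaller, of b x] by auto
    then show ?thesis using B_clique[of s b] b(1) by blast
  next
    case False
    then have dom: "H b x" if "b \<in> B" "x \<in> ?V" "x \<noteq> b" for b x using that by blast
    show ?thesis
    proof (cases "\<exists>c\<in>C. \<exists>x\<in>C. x \<noteq> c \<and> \<not> H c x")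
      case True
      then obtain c x where c: "c \<in> C" "x \<in> C" "x \<noteq> c" "\<not> H c x" by blast
      then obtain s where "s \<in> ?V" "s \<noteq> c" "\<not> H s c"
        "\<forall>a\<in>?V. \<forall>b\<in>?V. H s a \<longrightarrow> H s b \<longrightarrow> a \<noteq> b \<longrightarrow> H a b"
        using less.hyps[OF smaller, of c x] by auto
      then show ?thesis using dom[of s c] c(1) by blast
    next
      case False
      then have "H a b" if "a \<in> ?V" "b \<in> ?V" "a \<noteq> b" for a b
        using that dom sym by blast
      then show ?thesis using vC by blast
    qed
  qed
  then obtain s where s: "s \<in> C" "\<And>a b. a \<in> ?V \<Longrightarrow> b \<in> ?V \<Longrightarrow> H s a \<Longrightarrow> H s b \<Longrightarrow> a \<noteq> b \<Longrightarrow> H a b" by blast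
  have "a \<in> ?V" if "a \<in> V" "H s a" for a using that s(1) sym by (auto simp: B_def)
  then have "\<forall>a\<in>V. \<forall>b\<in>V. H s a \<longrightarrow> H s b \<longrightarrow> a \<noteq> b \<longrightarrow> H a b" using s(2) by blast
  moreover have "s \<in> V" "s \<noteq> u" "\<not> H s u" using s(1) CD sym by (auto simp: D_def)
  ultimately show ?case by blast
qed

text \<open>
  Without loops, apply Dirac's theorem to the complementary graph, with \<open>a\<close> as the given vertex:
  the simplicial vertex \<open>s\<close> is a neighbour of \<open>a\<close>, and its non-neighbours form an independent set.
\<close>

lemma covering_vertex:
  fixes I :: "('n::finite, 'k::field) mpoly set"
  assumes I: "monomial_ideal I" and F: "graded_free_resolution I F"
    and lin: "\<And>i q. q < res_rank F i \<Longrightarrow> res_deg F i q \<le> i + 2"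
    and ex: "edge I a b"
  shows "\<exists>v y. edge I v y \<and> (\<forall>a b. edge I a b \<longrightarrow> edge I v a \<or> edge I v b)"
proof (cases "\<exists>x. edge I x x")
  case True
  then obtain x where "edge I x x" ..
  then show ?thesis using loop_meets_edges[OF I F lin] by blast
next
  case False
  define H where "H x y \<longleftrightarrow> x \<noteq> y \<and> \<not> edge I x y" for x y
  have "\<exists>s\<in>UNIV. s \<noteq> a \<and> \<not> H s a \<and> (\<forall>x\<in>UNIV. \<forall>y\<in>UNIV. H s x \<longrightarrow> H s y \<longrightarrow> x \<noteq> y \<longrightarrow> H x y)"
  proof (rule simplicial_vertex[of H a UNIV b])
    fix W p q assume W: "p \<in> W" "q \<in> W" "H p q" "\<And>t. t \<in> W \<Longrightarrow> H t p \<Longrightarrow> \<not> H t q"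
    have "{(a, b). a \<in> W \<and> b \<in> W \<and> H a b \<and> {a, b} \<noteq> {p, q}} =
        {(a, b). a \<in> W \<and> b \<in> W \<and> a \<noteq> b \<and> \<not> edge I a b \<and> {a, b} \<noteq> {p, q}}"
      by (auto simp: H_def)
    moreover have "(p, q) \<notin> \<dots>\<^sup>*"
      by (rule coedge_separates[OF I F lin]) (use W in \<open>auto simp: H_def\<close>)
    ultimately show "(p, q) \<notin> {(a, b). a \<in> W \<and> b \<in> W \<and> H a b \<and> {a, b} \<noteq> {p, q}}\<^sup>*" by simp
  qed (use ex False in \<open>auto simp: H_def edge_sym\<close>)
  then obtain s where s: "s \<noteq> a" "\<not> H s a" "\<And>x y. H s x \<Longrightarrow> H s y \<Longrightarrow> x \<noteq> y \<Longrightarrow> H x y" by auto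
  have "edge I s a" using s by (simp add: H_def)
  moreover have "edge I s x \<or> edge I s y" if "edge I x y" for x y
    using s(3)[of x y] that False edge_sym unfolding H_def by blast
  ultimately show ?thesis by blast
qed

section \<open>The v-number\<close>

lemma prime_contains_variable:
  fixes P :: "('n::finite, 'k::field) mpoly set"
  assumes P: "primeideal P poly_ring" and "monomial m \<in> P"
  shows "\<exists>i. monomial (single i 1) \<in> P"
  using assms(2)
proof (induction m rule: exponent_induct)
  case zero
  have "f \<in> P" for f
    using zero ideal_mult[OF primeideal.axioms(1)[OF P], of 1 f] by (simp add: monomial_0)
  then have "P = carrier poly_ring" by (auto simp: ring_of_type_algebra_def)
  then show ?case using primeideal.I_notcarr[OF P] by simp
next
  case (add i m)
  have "monomial (single i 1) * monomial m \<in> P" using add by (simp add: monomial_times_monomial)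
  then have "monomial (single i 1) \<in> P \<or> monomial m \<in> P"
    using primeideal.I_prime[OF P, of "monomial (single i 1)" "monomial m"]
    by (simp add: ring_of_type_algebra_def)
  then show ?case using add.IH by blast
qed

lemma single_Suc: "single i (Suc k) = single i 1 + single i k"
  by (simp add: One_nat_def flip: single_add)

lemma edge_power:
  assumes "edge I a b"
  shows "monomial (single a k + single b k) \<in> ideal_power I k"
proof (induction k)
  case (Suc k)
  have "monomial (single a k + single b k) * monomial (single a 1 + single b 1) \<in> ideal_power I (Suc k)"
    using Suc assms unfolding edge_def by (rule ideal_power_Suc_mult)
  moreover have "single a k + single b k + (single a 1 + single b 1) = single a (Suc k) + single b (Suc k)"
    by (simp add: single_Suc ac_simps)
  ultimately show ?case by (simp add: monomial_times_monomial)
qed (simp add: ideal_power_0)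

text \<open>
  The weight \<open>w\<close> witnesses that a monomial outside the prime cannot carry \<open>\<mu>\<close> into \<open>J\<close>: it adds
  no weight to \<open>\<mu>\<close>, which falls short of \<open>c\<close>.
\<close>

lemma colon_monomial:
  fixes J :: "('n::finite, 'k::field) mpoly set"
  assumes J: "ideal J poly_ring"
    and weight: "\<And>f m. f \<in> J \<Longrightarrow> m \<in> keys f \<Longrightarrow> c \<le> weighted_degree w m" "weighted_degree w \<mu> < c"
    and N: "\<And>i. w i > 0 \<Longrightarrow> i \<in> N" "\<And>i. i \<in> N \<Longrightarrow> monomial (single i 1 + \<mu>) \<in> J"
  shows "colon J (monomial \<mu>) = supported_on (meets N)"
proof -
  have keys: "keys (g * monomial \<mu>) = (\<lambda>r. \<mu> + r) ` keys g" for g :: "('n, 'k) mpoly"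
    using keys_single_times[of "1 :: 'k" \<mu> g] by (simp add: monomial_def mult.commute)
  have "g \<in> supported_on (meets N)" if "g * monomial \<mu> \<in> J" for g
    unfolding supported_on_def
  proof (intro CollectI subsetI)
    fix m assume "m \<in> keys g"
    then have "c \<le> weighted_degree w (\<mu> + m)" using weight(1)[OF that] keys by blast
    then have "weighted_degree w m > 0" using weight(2) by simp
    then obtain i where "w i * lookup m i > 0"
      unfolding weighted_degree_def by (metis (no_types, lifting) gr0I sum.neutral)
    then show "m \<in> meets N" using N(1) by (auto simp: meets_def)
  qed
  moreover have "g * monomial \<mu> \<in> J" if g: "g \<in> supported_on (meets N)" for g
  proof (rule ideal_if_monomials[OF J])
    fix m assume "m \<in> keys (g * monomial \<mu>)"
    then obtain r where r: "r \<in> keys g" "m = \<mu> + r" using keys by auto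
    then obtain i where i: "i \<in> N" "lookup r i > 0" using g by (auto simp: supported_on_def meets_def)
    obtain r' where r': "r = single i 1 + r'" using factor_out_variable[OF i(2)] by blast
    have "monomial r' * monomial (single i 1 + \<mu>) \<in> J" by (rule ideal_mult[OF J N(2)[OF i(1)]])
    then show "monomial m \<in> J" by (simp add: r r' monomial_times_monomial ac_simps)
  qed
  ultimately show ?thesis by (auto simp: colon_def)
qed

theorem theorem4p11:
  fixes I :: "('n::finite, 'k::field) mpoly set"
  assumes "monomial_ideal I"
    and "I \<noteq> {0}"
    and "alpha I = 2"
    and "has_linear_resolution I"
  shows "\<forall>k\<ge>1. v_number (ideal_power I k) = 2 * k - 1"
proof (intro allI impI)
  fix k :: nat assume "1 \<le> k"
  then obtain j where k: "k = Suc j" by (cases k) (auto simp: One_nat_def)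
  note ideal = monomial_ideal_ideal[OF assms(1)]
  note ideal_k = ideal_ideal_power[OF ideal, of k]
  have gen: "equigenerated I" using assms(4) by (simp add: has_linear_resolution_def)
  note quad = quadratic_monomial_ideal[OF assms(1) gen assms(2,3)]
  obtain F where F: "graded_free_resolution I F" "\<And>i q. q < res_rank F i \<Longrightarrow> res_deg F i q \<le> i + 2"
    using linear_resolution_bounded[OF assms(4,3)] by blast
  obtain v z where vz: "edge I v z" and cover: "\<And>a b. edge I a b \<Longrightarrow> edge I v a \<or> edge I v b"
    using covering_vertex[OF assms(1) F] quad(2) by blast
  define N where "N = {u. edge I v u}"
  have weight: "c * k \<le> weighted_degree w m"
    if "\<And>a b. edge I a b \<Longrightarrow> c \<le> w a + w b" "f \<in> ideal_power I k" "m \<in> keys f" for c w f m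
  proof (rule weighted_degree_ideal_power[OF _ that(2,3)])
    fix f m assume "f \<in> I" "m \<in> keys f"
    then obtain a b r where "m = r + (single a 1 + single b 1)" "edge I a b" using quad(1) by blast
    then show "c \<le> weighted_degree w m" using that(1)[of a b] by simp
  qed
  \<comment> \<open>Taking \<open>y = v\<close> at a loop makes \<open>\<mu>\<close> below serve both cases: it is the exponent of
    \<open>x\<^sub>v\<^sup>2\<^sup>k\<^sup>-\<^sup>1\<close> if \<open>v\<close> has a loop and of \<open>x\<^sub>v\<^sup>k x\<^sub>y\<^sup>k\<^sup>-\<^sup>1\<close> otherwise.\<close>
  obtain y where y: "edge I v y" "edge I v v \<Longrightarrow> y = v"
    using vz by (cases "edge I v v") auto
  define \<mu> where "\<mu> = single v (Suc j) + single y j"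
  have mem: "monomial (single i 1 + \<mu>) \<in> ideal_power I k" if "i \<in> N" for i
  proof -
    have "monomial (single v j + single y j) * monomial (single v 1 + single i 1) \<in> ideal_power I (Suc j)"
      using edge_power[OF y(1)] that by (intro ideal_power_Suc_mult) (auto simp: N_def edge_def)
    moreover have "single v j + single y j + (single v 1 + single i 1) = single i 1 + \<mu>"
      by (simp add: \<mu>_def single_Suc ac_simps)
    ultimately show ?thesis by (simp add: k monomial_times_monomial)
  qed
  have colon: "colon (ideal_power I k) (monomial \<mu>) = supported_on (meets N)"
  proof (cases "edge I v v")
    case True
    define w where "w u = (if u = v then 1 else if u \<in> N then 2 else 0 :: nat)" for u
    show ?thesis
    proof (rule colon_monomial[OF ideal_k])
      show "2 * k \<le> weighted_degree w m" if "f \<in> ideal_power I k" "m \<in> keys f" for f m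
        using weight[OF _ that, of 2 w] cover edge_sym by (fastforce simp: w_def N_def)
      show "weighted_degree w \<mu> < 2 * k" using y(2)[OF True] by (simp add: \<mu>_def w_def k)
      show "w i > 0 \<Longrightarrow> i \<in> N" for i using True by (auto simp: w_def N_def split: if_splits)
    qed (rule mem)
  next
    case False
    define w where "w u = (if u \<in> N then 1 else 0 :: nat)" for u
    show ?thesis
    proof (rule colon_monomial[OF ideal_k])
      show "1 * k \<le> weighted_degree w m" if "f \<in> ideal_power I k" "m \<in> keys f" for f m
        using weight[OF _ that, of 1 w] cover by (fastforce simp: w_def N_def)
      show "weighted_degree w \<mu> < 1 * k" using False y(1) by (simp add: \<mu>_def w_def k N_def)
      show "w i > 0 \<Longrightarrow> i \<in> N" for i by (auto simp: w_def split: if_splits)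
    qed (rule mem)
  qed
  show "v_number (ideal_power I k) = 2 * k - 1"
    unfolding v_number_def
  proof (rule Least_equality)
    have "monomial \<mu> \<in> (graded_comp (2 * k - 1) :: ('n, 'k) mpoly set)"
      by (simp add: graded_comp_def \<mu>_def k)
    moreover have "supported_on (meets N) \<in> Ass (ideal_power I k)"
      unfolding Ass_def using primeideal_supported_on_meets colon by blast
    ultimately show "\<exists>f\<in>graded_comp (2 * k - 1). \<exists>P\<in>Ass (ideal_power I k). colon (ideal_power I k) f = P"
      using colon by blast
  next
    fix d assume "\<exists>f\<in>graded_comp d. \<exists>P\<in>Ass (ideal_power I k). colon (ideal_power I k) f = P"
    then obtain f P where "f \<in> graded_comp d" "P \<in> Ass (ideal_power I k)" "colon (ideal_power I k) f = P"
      by blast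
    then have f: "f \<in> graded_comp d" "primeideal (colon (ideal_power I k) f) poly_ring"
      by (simp_all add: Ass_def)
    have "monomial (single v k + single y k) * f \<in> ideal_power I k"
      using ideal_mult[OF ideal_k edge_power[OF y(1)], of f] by (simp add: mult.commute)
    then obtain i where i: "monomial (single i 1) * f \<in> ideal_power I k"
      using prime_contains_variable[OF f(2)] by (auto simp: colon_def)
    have "f \<noteq> 0"
    proof
      assume "f = 0"
      then have "colon (ideal_power I k) f = carrier poly_ring"
        using ideal_zero[OF ideal_k] by (simp add: colon_def ring_of_type_algebra_def)
      then show False using primeideal.I_notcarr[OF f(2)] by simp
    qed
    then obtain m where m: "m \<in> keys f" by (metis keys_eq_empty ex_in_conv)
    then have "single i 1 + m \<in> keys (monomial (single i 1) * f)"
      by (simp add: monomial_def keys_single_times)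
    then have "2 * k \<le> weighted_degree (\<lambda>_. 1) (single i 1 + m)"
      by (intro weight[OF _ i]) simp
    moreover have "mdeg m = d" using f(1) m by (simp add: graded_comp_def)
    ultimately show "2 * k - 1 \<le> d" by (simp add: mdeg_eq_weighted_degree)
  qed
qed

end
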